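(* Let $R$ be a commutative ring which has either finitely many minimal prime ideals or finitely many maximal ideals. Then $R$ is an S-ring.
   Context: All rings are commutative with identity. A ring $R$ is called an S-ring if every finitely generated flat $R$-module is a projective $R$-module. *)

theory Defs
  imports "HOL-Algebra.Algebra"
begin

definition mod_hom ::
    "('a, 'r) ring_scheme \<Rightarrow> ('a, 'm, 'c) module_scheme \<Rightarrow> ('a, 'n, 'd) module_scheme \<Rightarrow> ('m \<Rightarrow> 'n) set" where
  "mod_hom R M N =
     {f \<in> carrier M \<rightarrow> carrier N.
        (\<forall>x\<in>carrier M. \<forall>y\<in>carrier M. f (x \<oplus>\<^bsub>M\<^esub> y) = f x \<oplus>\<^bsub>N\<^esub> f y) \<and>
        (\<forall>r\<in>carrier R. \<forall>x\<in>carrier M. f (r \<odot>\<^bsub>M\<^esub> x) = r \<odot>\<^bsub>N\<^esub> f x)}"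

definition fin_gen_module :: "('a, 'r) ring_scheme \<Rightarrow> ('a, 'm, 'c) module_scheme \<Rightarrow> bool" where
  "fin_gen_module R M \<longleftrightarrow> module R M \<and>
     (\<exists>A. finite A \<and> A \<subseteq> carrier M \<and> (\<forall>H. submodule H R M \<longrightarrow> A \<subseteq> H \<longrightarrow> H = carrier M))"


text \<open>
  The tensor product of two modules over a commutative ring is the free abelian group on pairs
  modulo the subgroup generated by the usual relations. Only its additive group is constructed:
  injectivity of an induced map does not involve the scalar action.
\<close>

definition tensor_rels ::
    "('a, 'r) ring_scheme \<Rightarrow> ('a, 'm, 'c) module_scheme \<Rightarrow> ('a, 'n, 'd) module_scheme \<Rightarrow> ('m \<times> 'n \<Rightarrow>\<^sub>0 int) set" where
  "tensor_rels R M N =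
     {frag_of (x \<oplus>\<^bsub>M\<^esub> x', y) - frag_of (x, y) - frag_of (x', y) | x x' y.
        x \<in> carrier M \<and> x' \<in> carrier M \<and> y \<in> carrier N} \<union>
     {frag_of (x, y \<oplus>\<^bsub>N\<^esub> y') - frag_of (x, y) - frag_of (x, y') | x y y'.
        x \<in> carrier M \<and> y \<in> carrier N \<and> y' \<in> carrier N} \<union>
     {frag_of (r \<odot>\<^bsub>M\<^esub> x, y) - frag_of (x, r \<odot>\<^bsub>N\<^esub> y) | r x y.
        r \<in> carrier R \<and> x \<in> carrier M \<and> y \<in> carrier N}"

definition tensor_rel_group ::
    "('a, 'r) ring_scheme \<Rightarrow> ('a, 'm, 'c) module_scheme \<Rightarrow> ('a, 'n, 'd) module_scheme \<Rightarrow> ('m \<times> 'n \<Rightarrow>\<^sub>0 int) set" where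
  "tensor_rel_group R M N =
     generate (free_Abelian_group (carrier M \<times> carrier N)) (tensor_rels R M N)"

definition tensor_product ::
    "('a, 'r) ring_scheme \<Rightarrow> ('a, 'm, 'c) module_scheme \<Rightarrow> ('a, 'n, 'd) module_scheme \<Rightarrow> ('m \<times> 'n \<Rightarrow>\<^sub>0 int) set monoid" where
  "tensor_product R M N =
     free_Abelian_group (carrier M \<times> carrier N) Mod tensor_rel_group R M N"

text \<open>
  The map induced by \<open>f\<close> from the tensor product of \<open>M\<close> and \<open>N\<close> to that of \<open>M\<close> and \<open>N'\<close>; it acts
  on the elements of the tensor products, which are cosets, see \<open>tensor_map_coset\<close> below.
\<close>

definition tensor_map ::
    "('a, 'r) ring_scheme \<Rightarrow> ('a, 'm, 'c) module_scheme \<Rightarrow> ('a, 'n, 'd) module_scheme \<Rightarrow> ('a, 'p, 'e) module_scheme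
      \<Rightarrow> ('n \<Rightarrow> 'p) \<Rightarrow> ('m \<times> 'n \<Rightarrow>\<^sub>0 int) set \<Rightarrow> ('m \<times> 'p \<Rightarrow>\<^sub>0 int) set" where
  "tensor_map R M N N' f C =
     tensor_rel_group R M N' <#>\<^bsub>free_Abelian_group (carrier M \<times> carrier N')\<^esub>
       frag_extend (\<lambda>(x, y). frag_of (x, f y)) ` C"


text \<open>
  A module is flat if tensoring with it preserves injections. HOL cannot quantify over the
  types of the test modules inside a definition, so these have their carriers in the fixed type
  \<^typ>\<open>(nat \<Rightarrow> 'a) set\<close>, where \<^typ>\<open>'a\<close> is the type of the ring elements. A countably generated
  module is a quotient of the module of finitely supported sequences in \<open>R\<close>, with cosets as its
  elements, so every submodule of a countably generated module has an isomorphic copy among the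
  test modules. This covers all finitely generated modules and all ideals of \<open>R\<close>, and
  injections between those already decide flatness for modules of arbitrary size.
\<close>

definition flat_module :: "('a, 'r) ring_scheme \<Rightarrow> ('a, 'm, 'c) module_scheme \<Rightarrow> bool" where
  "flat_module R M \<longleftrightarrow> module R M \<and>
     (\<forall>(N :: ('a, (nat \<Rightarrow> 'a) set) module) (N' :: ('a, (nat \<Rightarrow> 'a) set) module).
        module R N \<longrightarrow> module R N' \<longrightarrow>
        (\<forall>f \<in> mod_hom R N N'. inj_on f (carrier N) \<longrightarrow>
           inj_on (tensor_map R M N N' f) (carrier (tensor_product R M N))))"

text \<open>
  Projectivity, by lifting along surjections between modules with carriers in a type \<^typ>\<open>'n\<close>.
  It is a conclusion in what follows, so \<^typ>\<open>'n\<close> stays a parameter: a theorem in which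
  \<^typ>\<open>'n\<close> is a type variable gives the lifting property for test modules of every type.
  Source and target may share the type, as any two types embed into their sum.
\<close>

definition projective_module :: "'n itself \<Rightarrow> ('a, 'r) ring_scheme \<Rightarrow> ('a, 'm, 'c) module_scheme \<Rightarrow> bool" where
  "projective_module (_ :: 'n itself) R M \<longleftrightarrow> module R M \<and>
     (\<forall>(N :: ('a, 'n) module) (N' :: ('a, 'n) module).
        module R N \<longrightarrow> module R N' \<longrightarrow>
        (\<forall>g \<in> mod_hom R N N'. \<forall>f \<in> mod_hom R M N'. g ` carrier N = carrier N' \<longrightarrow>
           (\<exists>h \<in> mod_hom R M N. \<forall>x \<in> carrier M. g (h x) = f x)))"

text \<open>
  \<^typ>\<open>'m\<close> is the type of the elements of the finitely generated flat modules and \<^typ>\<open>'n\<close> that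
  of the test modules for projectivity; both are arbitrary.
\<close>

definition S_ring :: "'m itself \<Rightarrow> 'n itself \<Rightarrow> ('a, 'r) ring_scheme \<Rightarrow> bool" where
  "S_ring (_ :: 'm itself) (_ :: 'n itself) R \<longleftrightarrow> cring R \<and>
     (\<forall>M :: ('a, 'm) module.
        fin_gen_module R M \<longrightarrow> flat_module R M \<longrightarrow> projective_module TYPE('n) R M)"

definition minimal_primeideal :: "'a set \<Rightarrow> ('a, 'r) ring_scheme \<Rightarrow> bool" where
  "minimal_primeideal P R \<longleftrightarrow>
     primeideal P R \<and> (\<forall>Q. primeideal Q R \<longrightarrow> Q \<subseteq> P \<longrightarrow> Q = P)"


lemma tensor_rels_subset:
  assumes "module R M" "module R N"
  shows "tensor_rels R M N \<subseteq> carrier (free_Abelian_group (carrier M \<times> carrier N))"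
proof
  interpret M: module R M by fact
  interpret N: module R N by fact
  let ?S = "carrier M \<times> carrier N"
  have d: "Poly_Mapping.keys (a - b) \<subseteq> ?S"
    if "Poly_Mapping.keys a \<subseteq> ?S" "Poly_Mapping.keys b \<subseteq> ?S" for a b
    using that keys_diff[of a b] by blast
  have o: "Poly_Mapping.keys (frag_of (x, y)) \<subseteq> ?S" if "x \<in> carrier M" "y \<in> carrier N" for x y
    using that by simp
  fix c assume "c \<in> tensor_rels R M N"
  then have "Poly_Mapping.keys c \<subseteq> ?S"
    unfolding tensor_rels_def
    by (elim UnE CollectE exE conjE; hypsubst)
      (rule d o M.smult_closed N.smult_closed M.add.m_closed N.add.m_closed | assumption)+
  then show "c \<in> carrier (free_Abelian_group ?S)"
    by simp
qed

lemma frag_extend_tensor_rels: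
  assumes f: "f \<in> mod_hom R N N'" and c: "c \<in> tensor_rels R M N"
  shows "frag_extend (\<lambda>(x, y). frag_of (x, f y)) c \<in> tensor_rels R M N'"
proof -
  have f_closed: "f y \<in> carrier N'" if "y \<in> carrier N" for y
    using f that by (auto simp: mod_hom_def)
  have f_add: "f (y \<oplus>\<^bsub>N\<^esub> y') = f y \<oplus>\<^bsub>N'\<^esub> f y'" if "y \<in> carrier N" "y' \<in> carrier N" for y y'
    using f that by (auto simp: mod_hom_def)
  have f_smult: "f (r \<odot>\<^bsub>N\<^esub> y) = r \<odot>\<^bsub>N'\<^esub> f y" if "r \<in> carrier R" "y \<in> carrier N" for r y
    using f that by (auto simp: mod_hom_def)
  from c show ?thesis
    unfolding tensor_rels_def
  proof (elim UnE CollectE exE conjE, goal_cases)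
    case (1 x x' y)
    then show ?case
      by (intro UnI1 CollectI exI[of _ x] exI[of _ x'] exI[of _ "f y"])
        (simp add: frag_extend_diff f_closed)
  next
    case (2 x y y')
    then show ?case
      by (intro UnI1 UnI2 CollectI exI[of _ x] exI[of _ "f y"] exI[of _ "f y'"])
        (simp add: frag_extend_diff f_closed f_add)
  next
    case (3 r x y)
    then show ?case
      by (intro UnI2 CollectI exI[of _ r] exI[of _ x] exI[of _ "f y"])
        (simp add: frag_extend_diff f_closed f_smult)
  qed
qed

lemma subgroup_tensor_rel_group:
  assumes "module R M" "module R N"
  shows "subgroup (tensor_rel_group R M N) (free_Abelian_group (carrier M \<times> carrier N))"
  unfolding tensor_rel_group_def
  by (intro group.generate_is_subgroup tensor_rels_subset assms group_free_Abelian_group)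

lemma frag_extend_tensor_rel_group:
  assumes M: "module R M" and N: "module R N" and N': "module R N'"
    and f: "f \<in> mod_hom R N N'" and c: "c \<in> tensor_rel_group R M N"
  shows "frag_extend (\<lambda>(x, y). frag_of (x, f y)) c \<in> tensor_rel_group R M N'"
  using c unfolding tensor_rel_group_def
proof (induction rule: generate.induct)
  case one
  then show ?case
    using generate.one[of "free_Abelian_group (carrier M \<times> carrier N')"] by simp
next
  case (incl h)
  then show ?case
    by (intro generate.incl frag_extend_tensor_rels[OF f])
next
  case (inv h)
  have h: "Poly_Mapping.keys h \<subseteq> carrier M \<times> carrier N"
    using subsetD[OF tensor_rels_subset[OF M N] inv] by simp
  let ?h = "frag_extend (\<lambda>(x, y). frag_of (x, f y)) h"
  have h': "?h \<in> tensor_rels R M N'"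
    using inv by (rule frag_extend_tensor_rels[OF f])
  have "Poly_Mapping.keys ?h \<subseteq> carrier M \<times> carrier N'"
    using subsetD[OF tensor_rels_subset[OF M N'] h'] by simp
  then show ?case
    using generate.inv[OF h', of "free_Abelian_group (carrier M \<times> carrier N')"] h
    by (simp add: frag_extend_minus)
next
  case (eng h1 h2)
  then show ?case
    using generate.eng[of _ "free_Abelian_group (carrier M \<times> carrier N')"]
    by (simp add: frag_extend_add)
qed

lemma tensor_map_coset:
  assumes M: "module R M" and N: "module R N" and N': "module R N'"
    and f: "f \<in> mod_hom R N N'" and c: "Poly_Mapping.keys c \<subseteq> carrier M \<times> carrier N"
  shows "tensor_map R M N N' f
           (tensor_rel_group R M N #>\<^bsub>free_Abelian_group (carrier M \<times> carrier N)\<^esub> c) =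
         tensor_rel_group R M N' #>\<^bsub>free_Abelian_group (carrier M \<times> carrier N')\<^esub>
           frag_extend (\<lambda>(x, y). frag_of (x, f y)) c"
proof -
  let ?J = "tensor_rel_group R M N" and ?J' = "tensor_rel_group R M N'"
  let ?e = "frag_extend (\<lambda>(x, y). frag_of (x, f y))"
  have "{a + ?e (b + c) | a b. a \<in> ?J' \<and> b \<in> ?J} = {a + ?e c | a. a \<in> ?J'}"
  proof (intro equalityI subsetI)
    fix z assume "z \<in> {a + ?e (b + c) | a b. a \<in> ?J' \<and> b \<in> ?J}"
    then obtain a b where z: "z = a + ?e (b + c)" "a \<in> ?J'" "b \<in> ?J" by blast
    have "a + ?e b \<in> ?J'"
      using subgroup.m_closed[OF subgroup_tensor_rel_group[OF M N'] z(2)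
          frag_extend_tensor_rel_group[OF M N N' f z(3)]] by simp
    then show "z \<in> {a + ?e c | a. a \<in> ?J'}"
      using z(1) by (auto simp: frag_extend_add add.assoc intro!: exI[of _ "a + ?e b"])
  next
    fix z assume "z \<in> {a + ?e c | a. a \<in> ?J'}"
    moreover have "0 \<in> ?J"
      using subgroup.one_closed[OF subgroup_tensor_rel_group[OF M N]] by simp
    ultimately show "z \<in> {a + ?e (b + c) | a b. a \<in> ?J' \<and> b \<in> ?J}"
      by (force intro: exI[of _ "0::_ \<Rightarrow>\<^sub>0 int"])
  qed
  then show ?thesis
    unfolding tensor_map_def r_coset_def set_mult_def by (simp; blast)
qed

end

theory Submission
  imports Defs
begin

text \<open>Write a finitely generated flat module \<open>M\<close> as a quotient of a free module \<open>F\<close> of finite rank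
  with module of relations \<open>K\<close>. By the equational criterion every finite subset of \<open>K\<close> is annihilated
  by an endomorphism \<open>\<alpha>\<close> of \<open>F\<close> that induces the identity on \<open>M\<close>, and \<open>M\<close> is projective as soon as
  one such \<open>\<alpha>\<close> annihilates all of \<open>K\<close>. Locally at a prime \<open>P\<close> finitely many relations generate \<open>K\<close>;
  so for finitely many primes there is an \<open>\<alpha>\<close> such that \<open>\<alpha> K\<close> vanishes locally at all of them. If
  these are the maximal ideals, then \<open>\<alpha> K = 0\<close>. If they are the minimal primes, then the entries of
  \<open>\<alpha> K\<close> are nilpotent, hence so is the matrix \<open>\<alpha> (1 - \<alpha>)\<close>; as \<open>1 - \<alpha>\<close> is injective on \<open>K\<close>, some power
  of \<open>\<alpha>\<close> annihilates \<open>K\<close>.\<close>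

section \<open>Prime and maximal ideals\<close>

lemma (in abelian_group) minus_zero_right: "x \<in> carrier G \<Longrightarrow> x \<ominus> \<zero> = x"
  by (metis a_inv_closed a_minus_def l_zero r_neg r_zero zero_closed)

lemma (in abelian_group) eq_if_minus_eq_zero:
  assumes "x \<in> carrier G" "y \<in> carrier G" "x \<ominus> y = \<zero>"
  shows "x = y"
proof -
  have "x \<ominus> y \<oplus> y = x" using assms(1,2) by (simp add: a_minus_def a_assoc l_neg)
  then show ?thesis using assms by simp
qed

lemma (in ideal) finsum_ideal_closed:
  assumes "finite S" "\<And>i. i \<in> S \<Longrightarrow> f i \<in> I"
  shows "(\<Oplus>i\<in>S. f i) \<in> I"
  using assms
proof (induction S rule: finite_induct)
  case (insert k S)
  then have "f \<in> S \<rightarrow> carrier R" "f k \<in> carrier R" using Icarr by auto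
  then show ?case using insert by simp
qed simp

lemma (in cring) exists_maximalideal:
  assumes I: "ideal I R" "\<one> \<notin> I"
  obtains P where "maximalideal P R" "I \<subseteq> P"
proof -
  let ?A = "{J. ideal J R \<and> \<one> \<notin> J \<and> I \<subseteq> J}"
  have "\<exists>P\<in>?A. \<forall>J\<in>?A. P \<subseteq> J \<longrightarrow> J = P"
  proof (rule subset_Zorn_nonempty)
    show "?A \<noteq> {}" using I by blast
  next
    fix C assume C: "C \<noteq> {}" "subset.chain ?A C"
    then have CA: "C \<subseteq> ?A" and ch: "\<And>U V. U \<in> C \<Longrightarrow> V \<in> C \<Longrightarrow> U \<subseteq> V \<or> V \<subseteq> U"
      unfolding subset.chain_def by blast+
    obtain U0 where U0: "U0 \<in> C" using C by blast
    have idl: "ideal U R" if "U \<in> C" for U using CA that by blast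
    have "ideal (\<Union>C) R"
    proof (rule idealI[OF ring_axioms])
      show "subgroup (\<Union>C) (add_monoid R)"
      proof (rule add.subgroupI)
        show "\<Union>C \<subseteq> carrier R"
          using idl ideal.Icarr by fastforce
        show "\<Union>C \<noteq> {}"
          using U0 additive_subgroup.zero_closed[OF ideal.axioms(1)[OF idl[OF U0]]] by blast
      next
        fix a assume "a \<in> \<Union>C"
        then obtain U where U: "U \<in> C" "a \<in> U" by blast
        then have "\<ominus> a \<in> U"
          using additive_subgroup.a_inv_closed[OF ideal.axioms(1)[OF idl]] by simp
        then show "\<ominus> a \<in> \<Union>C" using U by blast
      next
        fix a b assume "a \<in> \<Union>C" "b \<in> \<Union>C"
        then obtain U where U: "U \<in> C" "a \<in> U" "b \<in> U" using ch by blast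
        then have "a \<oplus> b \<in> U"
          using additive_subgroup.a_closed[OF ideal.axioms(1)[OF idl]] by simp
        then show "a \<oplus> b \<in> \<Union>C" using U by blast
      qed
    next
      fix a x assume "a \<in> \<Union>C" and x: "x \<in> carrier R"
      then obtain U where U: "U \<in> C" "a \<in> U" by blast
      then show "x \<otimes> a \<in> \<Union>C" "a \<otimes> x \<in> \<Union>C"
        using ideal.I_l_closed[OF idl[OF U(1)] U(2) x] ideal.I_r_closed[OF idl[OF U(1)] U(2) x]
        by blast+
    qed
    then show "\<Union>C \<in> ?A" using CA U0 by blast
  qed
  then obtain P where P: "ideal P R" "\<one> \<notin> P" "I \<subseteq> P"
    and mx: "\<And>J. ideal J R \<Longrightarrow> \<one> \<notin> J \<Longrightarrow> P \<subseteq> J \<Longrightarrow> J = P" by (smt (verit) mem_Collect_eq subset_trans)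
  have "maximalideal P R"
  proof (rule maximalidealI[OF P(1)])
    show "carrier R \<noteq> P" using P(2) by blast
    fix J assume "ideal J R" "P \<subseteq> J" "J \<subseteq> carrier R"
    then show "J = P \<or> J = carrier R"
      using mx ideal.one_imp_carrier by blast
  qed
  then show thesis using that P(3) by blast
qed

lemma (in module) ideal_annihilator:
  assumes "y \<in> carrier M"
  shows "ideal {s \<in> carrier R. s \<odot>\<^bsub>M\<^esub> y = \<zero>\<^bsub>M\<^esub>} R"
proof (rule idealI[OF R.ring_axioms])
  show "subgroup {s \<in> carrier R. s \<odot>\<^bsub>M\<^esub> y = \<zero>\<^bsub>M\<^esub>} (add_monoid R)"
    by (rule R.add.subgroupI) (use assms in \<open>auto simp: smult_l_distr smult_l_minus\<close>)
  fix a x assume ax: "a \<in> {s \<in> carrier R. s \<odot>\<^bsub>M\<^esub> y = \<zero>\<^bsub>M\<^esub>}" "x \<in> carrier R"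
  then show 1: "x \<otimes> a \<in> {s \<in> carrier R. s \<odot>\<^bsub>M\<^esub> y = \<zero>\<^bsub>M\<^esub>}"
    using assms by (simp add: smult_assoc1)
  then show "a \<otimes> x \<in> {s \<in> carrier R. s \<odot>\<^bsub>M\<^esub> y = \<zero>\<^bsub>M\<^esub>}"
    using ax by (simp add: R.m_comm)
qed

lemma (in module) zero_if_locally_zero:
  assumes y: "y \<in> carrier M"
    and loc: "\<And>P. maximalideal P R \<Longrightarrow> \<exists>s\<in>carrier R - P. s \<odot>\<^bsub>M\<^esub> y = \<zero>\<^bsub>M\<^esub>"
  shows "y = \<zero>\<^bsub>M\<^esub>"
proof (rule ccontr)
  assume "y \<noteq> \<zero>\<^bsub>M\<^esub>"
  then have "\<one> \<notin> {s \<in> carrier R. s \<odot>\<^bsub>M\<^esub> y = \<zero>\<^bsub>M\<^esub>}" using y by simp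
  then obtain P where "maximalideal P R" "{s \<in> carrier R. s \<odot>\<^bsub>M\<^esub> y = \<zero>\<^bsub>M\<^esub>} \<subseteq> P"
    using R.exists_maximalideal[OF ideal_annihilator[OF y]] by metis
  with loc show False by blast
qed

lemma (in cring) diagonally_dominant_elimination:
  assumes P: "primeideal P R" and "finite S" and x: "x \<in> S \<rightarrow> carrier R"
    and b: "\<And>i j. i \<in> S \<Longrightarrow> j \<in> S \<Longrightarrow> b i j \<in> carrier R"
    and diag: "\<And>i. i \<in> S \<Longrightarrow> b i i \<notin> P"
    and off: "\<And>i j. i \<in> S \<Longrightarrow> j \<in> S \<Longrightarrow> i \<noteq> j \<Longrightarrow> b i j \<in> P"
    and eq: "\<And>j. j \<in> S \<Longrightarrow> (\<Oplus>i\<in>S. x i \<otimes> b i j) = \<zero>"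
  shows "\<exists>s\<in>carrier R - P. \<forall>i\<in>S. s \<otimes> x i = \<zero>"
  using assms(2-)
proof (induction S arbitrary: b rule: finite_induct)
  case empty
  then show ?case
    using primeideal.I_notcarr[OF P] ideal.one_imp_carrier[OF primeideal.axioms(1)[OF P]] by auto
next
  case (insert k S)
  interpret P: primeideal P R by (rule P)
  have xk: "x k \<in> carrier R" and xS: "x \<in> S \<rightarrow> carrier R" and xi: "\<And>i. i \<in> S \<Longrightarrow> x i \<in> carrier R"
    using insert.prems by auto
  note bc = insert.prems(2)
  define b' where "b' = (\<lambda>i j. b k k \<otimes> b i j \<oplus> (\<ominus> b k j) \<otimes> b i k)"
  have "\<exists>s\<in>carrier R - P. \<forall>i\<in>S. s \<otimes> x i = \<zero>"
  proof (rule insert.IH[OF xS, of b'])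
    fix i j assume ij: "i \<in> S" "j \<in> S"
    show "b' i j \<in> carrier R" using ij bc by (simp add: b'_def)
    show "b' i j \<in> P" if "i \<noteq> j"
      unfolding b'_def
      by (intro P.a_closed P.I_l_closed insert.prems(4)) (use ij that insert bc in auto)
  next
    fix i assume i: "i \<in> S"
    have 1: "(\<ominus> b k i) \<otimes> b i k \<in> P"
      by (intro P.I_l_closed insert.prems(4)) (use i insert bc in auto)
    have 2: "b k k \<otimes> b i i \<notin> P"
      using P.I_prime[of "b k k" "b i i"] i insert.prems(3) bc by auto
    show "b' i i \<notin> P"
    proof
      assume "b' i i \<in> P"
      then have "b' i i \<ominus> (\<ominus> b k i) \<otimes> b i k \<in> P" using 1 P.a_closed P.a_inv_closed
        by (simp add: minus_eq)
      moreover have "b' i i \<ominus> (\<ominus> b k i) \<otimes> b i k = b k k \<otimes> b i i"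
        unfolding b'_def using i bc by (simp add: minus_eq a_assoc r_neg)
      ultimately show False using 2 by simp
    qed
  next
    fix j assume j: "j \<in> S"
    define s1 where "s1 = (\<Oplus>i\<in>S. x i \<otimes> b i j)"
    define s2 where "s2 = (\<Oplus>i\<in>S. x i \<otimes> b i k)"
    have c: "s1 \<in> carrier R" "s2 \<in> carrier R"
      unfolding s1_def s2_def using bc xi j by (auto intro!: finsum_closed)
    have e1: "x k \<otimes> b k j \<oplus> s1 = \<zero>"
      using insert.prems(5)[of j] j insert.hyps bc xi xk unfolding s1_def by (simp add: Pi_def)
    have e2: "x k \<otimes> b k k \<oplus> s2 = \<zero>"
      using insert.prems(5)[of k] j insert.hyps bc xi xk unfolding s2_def by (simp add: Pi_def)
    have "(\<Oplus>i\<in>S. x i \<otimes> b' i j) = (\<Oplus>i\<in>S. b k k \<otimes> (x i \<otimes> b i j) \<oplus> (\<ominus> b k j) \<otimes> (x i \<otimes> b i k))"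
    proof (rule finsum_cong')
      fix i assume i: "i \<in> S"
      have "x i \<in> carrier R" "b i j \<in> carrier R" "b i k \<in> carrier R" "b k k \<in> carrier R" "b k j \<in> carrier R"
        using bc xi i j by auto
      then show "x i \<otimes> b' i j = b k k \<otimes> (x i \<otimes> b i j) \<oplus> (\<ominus> b k j) \<otimes> (x i \<otimes> b i k)"
        unfolding b'_def by algebra
    qed (use bc xi j in auto)
    also have "\<dots> = b k k \<otimes> s1 \<oplus> (\<ominus> b k j) \<otimes> s2"
      unfolding s1_def s2_def using bc xi j insert.hyps
      by (simp add: finsum_addf finsum_rdistr Pi_def)
    also have "\<dots> = b k k \<otimes> (x k \<otimes> b k j \<oplus> s1) \<ominus> b k j \<otimes> (x k \<otimes> b k k \<oplus> s2)"
      using c xk bc[of k k, OF insertI1 insertI1] bc[of k j, OF insertI1 insertI2[OF j]] by algebra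
    also have "\<dots> = \<zero>" unfolding e1 e2 using bc j by (simp add: minus_eq)
    finally show "(\<Oplus>i\<in>S. x i \<otimes> b' i j) = \<zero>" .
  qed
  then obtain s where s: "s \<in> carrier R" "s \<notin> P" "\<And>i. i \<in> S \<Longrightarrow> s \<otimes> x i = \<zero>" by blast
  have bkk: "b k k \<in> carrier R" "b k k \<notin> P" using bc insert.prems(3) by auto
  have sb: "s \<otimes> b k k \<in> carrier R" "s \<otimes> b k k \<notin> P"
    using s bkk P.I_prime by auto
  have "s \<otimes> (\<Oplus>i\<in>S. x i \<otimes> b i k) = (\<Oplus>i\<in>S. s \<otimes> (x i \<otimes> b i k))"
    using s bc xi insert.hyps by (simp add: finsum_rdistr Pi_def)
  also have "\<dots> = (\<Oplus>i\<in>S. \<zero>)"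
    by (rule finsum_cong') (use s bc xi in \<open>auto simp: m_assoc[symmetric]\<close>)
  finally have z: "s \<otimes> (\<Oplus>i\<in>S. x i \<otimes> b i k) = \<zero>" by simp
  have cc: "(\<Oplus>i\<in>S. x i \<otimes> b i k) \<in> carrier R" using bc xi by (auto intro!: finsum_closed)
  have e: "x k \<otimes> b k k \<oplus> (\<Oplus>i\<in>S. x i \<otimes> b i k) = \<zero>"
    using insert.prems(5)[of k] insert.hyps bc xi xk by (simp add: Pi_def)
  have "s \<otimes> b k k \<otimes> x k = s \<otimes> (x k \<otimes> b k k \<oplus> (\<Oplus>i\<in>S. x i \<otimes> b i k))"
    using z cc s xk bkk by (simp add: r_distr m_ac)
  then have "s \<otimes> b k k \<otimes> x k = \<zero>" unfolding e using s by simp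
  moreover have "s \<otimes> b k k \<otimes> x i = \<zero>" if "i \<in> S" for i
  proof -
    have "s \<otimes> b k k \<otimes> x i = b k k \<otimes> (s \<otimes> x i)"
      using xi[OF that] s bkk by (simp add: m_ac)
    then show ?thesis using s(3)[OF that] bkk by simp
  qed
  ultimately show ?case using sb by auto
qed

text \<open>The complement of a multiplicative set that is maximal among those avoiding zero is a
  minimal prime.\<close>

lemma (in cring) nilpotent_if_in_minimal_primes:
  assumes z: "z \<in> carrier R" and minp: "\<And>P. minimal_primeideal P R \<Longrightarrow> z \<in> P"
  shows "\<exists>n::nat. z [^] n = \<zero>"
proof (rule ccontr)
  assume nn: "\<nexists>n::nat. z [^] n = \<zero>"
  define mult where "mult S \<longleftrightarrow> S \<subseteq> carrier R \<and> \<one> \<in> S \<and> (\<forall>a\<in>S. \<forall>b\<in>S. a \<otimes> b \<in> S) \<and> \<zero> \<notin> S" for S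
  let ?A = "{S. mult S \<and> z \<in> S}"
  have "\<exists>S\<in>?A. \<forall>T\<in>?A. S \<subseteq> T \<longrightarrow> T = S"
  proof (rule subset_Zorn_nonempty)
    have "mult (range (\<lambda>n::nat. z [^] n))"
      unfolding mult_def using z nn
      by (auto simp: nat_pow_mult image_iff intro: exI[of _ "0::nat"])
    moreover have "z \<in> range (\<lambda>n::nat. z [^] n)"
      using z by (intro image_eqI[of _ _ 1]) auto
    ultimately show "?A \<noteq> {}" by blast
  next
    fix C assume C: "C \<noteq> {}" "subset.chain ?A C"
    then have CA: "C \<subseteq> ?A" and ch: "\<And>U V. U \<in> C \<Longrightarrow> V \<in> C \<Longrightarrow> U \<subseteq> V \<or> V \<subseteq> U"
      unfolding subset.chain_def by blast+
    have "a \<otimes> b \<in> \<Union>C" if ab: "a \<in> \<Union>C" "b \<in> \<Union>C" for a b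
    proof -
      obtain U where "U \<in> C" "a \<in> U" "b \<in> U" using ch ab by blast
      then show ?thesis using CA unfolding mult_def by blast
    qed
    then have "mult (\<Union>C)"
      using C(1) CA unfolding mult_def by blast
    then show "\<Union>C \<in> ?A" using C(1) CA by blast
  qed
  then obtain S where S: "mult S" "z \<in> S" and mx: "\<And>T. mult T \<Longrightarrow> S \<subseteq> T \<Longrightarrow> T = S"
    by (smt (verit) mem_Collect_eq subset_iff)
  have Sc: "S \<subseteq> carrier R" and S1: "\<one> \<in> S" and Sm: "\<And>a b. a \<in> S \<Longrightarrow> b \<in> S \<Longrightarrow> a \<otimes> b \<in> S" and S0: "\<zero> \<notin> S"
    using S(1) unfolding mult_def by auto
  have Sp: "a [^] n \<in> S" if "a \<in> S" for a and n :: nat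
    by (induction n) (use S1 Sm that in auto)
  define I where "I = {r \<in> carrier R. \<exists>s\<in>S. s \<otimes> r = \<zero>}"
  have pow: "\<exists>n::nat. a [^] n \<in> I" if a: "a \<in> carrier R" "a \<notin> S" for a
  proof (rule ccontr)
    assume no: "\<nexists>n::nat. a [^] n \<in> I"
    define T where "T = {s \<otimes> a [^] n | s n. s \<in> S \<and> n \<in> (UNIV :: nat set)}"
    have "mult T"
      unfolding mult_def
    proof (intro conjI ballI)
      show "T \<subseteq> carrier R" using Sc a by (auto simp: T_def)
      show "\<one> \<in> T" unfolding T_def using S1 by (auto intro!: exI[of _ \<one>] exI[of _ "0::nat"])
      show "\<zero> \<notin> T"
      proof
        assume "\<zero> \<in> T"
        then obtain s n where "s \<in> S" "s \<otimes> a [^] (n::nat) = \<zero>" unfolding T_def by force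
        then have "a [^] n \<in> I" using a unfolding I_def by auto
        then show False using no by blast
      qed
      fix c d assume "c \<in> T" "d \<in> T"
      then obtain s n t m where "c = s \<otimes> a [^] (n::nat)" "d = t \<otimes> a [^] (m::nat)" "s \<in> S" "t \<in> S"
        unfolding T_def by auto
      moreover from this have "c \<otimes> d = (s \<otimes> t) \<otimes> a [^] (n + m)"
        using a Sc by (simp add: subset_iff nat_pow_mult[symmetric] m_ac)
      ultimately show "c \<otimes> d \<in> T" unfolding T_def using Sm by blast
    qed
    moreover have "S \<subseteq> T"
    proof
      fix s assume "s \<in> S"
      then show "s \<in> T" unfolding T_def using Sc by (auto intro!: exI[of _ s] exI[of _ "0::nat"])
    qed
    ultimately have "T = S" by (rule mx)
    moreover have "a \<in> T" unfolding T_def using S1 a by (auto intro!: exI[of _ \<one>] exI[of _ "1::nat"])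
    ultimately show False using a by simp
  qed
  have Ic: "I \<subseteq> carrier R" by (auto simp: I_def)
  have Iadd: "a \<oplus> b \<in> I" if ab: "a \<in> I" "b \<in> I" for a b
  proof -
    obtain s t where st: "s \<in> S" "t \<in> S" "s \<otimes> a = \<zero>" "t \<otimes> b = \<zero>" "a \<in> carrier R" "b \<in> carrier R"
      using ab unfolding I_def by auto
    have "(s \<otimes> t) \<otimes> (a \<oplus> b) = t \<otimes> (s \<otimes> a) \<oplus> s \<otimes> (t \<otimes> b)"
      using subsetD[OF Sc st(1)] subsetD[OF Sc st(2)] st(5,6) by algebra
    then have "(s \<otimes> t) \<otimes> (a \<oplus> b) = \<zero>" using st Sc by (simp add: subset_iff)
    then show ?thesis using Sm[OF st(1,2)] st unfolding I_def by auto
  qed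
  have Imul: "r \<otimes> a \<in> I" if ra: "r \<in> carrier R" "a \<in> I" for r a
  proof -
    obtain s where s: "s \<in> S" "s \<otimes> a = \<zero>" "a \<in> carrier R"
      using ra unfolding I_def by auto
    have "s \<otimes> (r \<otimes> a) = r \<otimes> (s \<otimes> a)" using s(3) ra(1) subsetD[OF Sc s(1)] by algebra
    then show ?thesis using s ra unfolding I_def by auto
  qed
  have Idiv: "v \<in> I" if cv: "c \<in> S" "v \<in> carrier R" "c \<otimes> v \<in> I" for c v
  proof -
    obtain s where s: "s \<in> S" "s \<otimes> (c \<otimes> v) = \<zero>" using cv unfolding I_def by auto
    then have "(s \<otimes> c) \<otimes> v = \<zero>" using that Sc by (simp add: subset_iff m_assoc)
    then show ?thesis using that Sm s unfolding I_def by blast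
  qed
  have I1: "\<one> \<notin> I" using Sc S0 unfolding I_def by auto
  have addS: "u \<in> I" if "u \<in> carrier R" "a \<in> carrier R" "b \<in> carrier R" "a \<oplus> b \<in> S"
    "u \<otimes> a [^] (n::nat) \<in> I" "u \<otimes> b [^] (m::nat) \<in> I" for u a b n m
    using that
  proof (induction "n + m" arbitrary: n m u rule: less_induct)
    case less
    show ?case
    proof (cases "n = 0 \<or> m = 0")
      case True
      then show ?thesis using less.prems by auto
    next
      case False
      then obtain n' m' where nm: "n = Suc n'" "m = Suc m'" by (metis not0_implies_Suc)
      have "u \<otimes> a \<in> I"
      proof (rule less.hyps[of n' m])
        show "u \<otimes> a \<otimes> a [^] n' \<in> I"
          using less.prems unfolding nm by (simp add: m_ac)
        have "u \<otimes> a \<otimes> b [^] m = a \<otimes> (u \<otimes> b [^] m)" using less.prems by (simp add: m_ac)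
        then show "u \<otimes> a \<otimes> b [^] m \<in> I" using Imul less.prems by simp
      qed (use less.prems nm in auto)
      moreover have "u \<otimes> b \<in> I"
      proof (rule less.hyps[of n m'])
        show "u \<otimes> b \<otimes> b [^] m' \<in> I"
          using less.prems unfolding nm by (simp add: m_ac)
        have "u \<otimes> b \<otimes> a [^] n = b \<otimes> (u \<otimes> a [^] n)" using less.prems by (simp add: m_ac)
        then show "u \<otimes> b \<otimes> a [^] n \<in> I" using Imul less.prems by simp
      qed (use less.prems nm in auto)
      ultimately have "u \<otimes> a \<oplus> u \<otimes> b \<in> I" by (rule Iadd)
      then have "(a \<oplus> b) \<otimes> u \<in> I" using less.prems by (simp add: r_distr l_distr m_comm)
      then show ?thesis using Idiv less.prems by blast
    qed
  qed
  define P where "P = carrier R - S"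
  have mulP: "r \<otimes> a \<in> P" if "r \<in> carrier R" "a \<in> P" for r a
  proof -
    obtain n :: nat where n: "a [^] n \<in> I" using pow \<open>a \<in> P\<close> unfolding P_def by blast
    have "r \<otimes> a \<notin> S"
    proof
      assume "r \<otimes> a \<in> S"
      then have "(r \<otimes> a) [^] n \<in> S" by (rule Sp)
      moreover have "(r \<otimes> a) [^] n \<in> I"
        using Imul[OF _ n, of "r [^] n"] that unfolding P_def by (simp add: nat_pow_distrib)
      ultimately show False using Idiv[of "(r \<otimes> a) [^] n" \<one>] I1 Sc by auto
    qed
    then show ?thesis using that unfolding P_def by auto
  qed
  have addP: "a \<oplus> b \<in> P" if ab: "a \<in> P" "b \<in> P" for a b
  proof -
    obtain n m :: nat where n: "a [^] n \<in> I" "b [^] m \<in> I" using pow ab unfolding P_def by blast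
    show ?thesis
      using addS[of \<one> a b n m] n ab I1 Ic unfolding P_def by auto
  qed
  have idl: "ideal P R"
  proof (rule idealI[OF ring_axioms])
    show "subgroup P (add_monoid R)"
    proof (rule add.subgroupI)
      show "P \<noteq> {}" using S0 by (auto simp: P_def)
      fix a assume a: "a \<in> P"
      then have "\<ominus> a = (\<ominus> \<one>) \<otimes> a" by (simp add: P_def l_minus)
      then show "\<ominus> a \<in> P" using mulP[OF _ a, of "\<ominus> \<one>"] by simp
    qed (use addP in \<open>auto simp: P_def\<close>)
    fix a x assume "a \<in> P" "x \<in> carrier R"
    then show "x \<otimes> a \<in> P" "a \<otimes> x \<in> P"
      using mulP[of x a] by (auto simp: m_comm P_def)
  qed
  have "primeideal P R"
    by (rule primeidealI[OF idl cring_axioms]) (use S1 Sm in \<open>auto simp: P_def\<close>)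
  moreover have "Q = P" if Q: "primeideal Q R" "Q \<subseteq> P" for Q
  proof -
    interpret Q: primeideal Q R by (rule Q)
    have "mult (carrier R - Q)"
      unfolding mult_def using Q.I_prime Q.I_notcarr Q.one_imp_carrier Q.zero_closed by blast
    then have "carrier R - Q = S" using mx[of "carrier R - Q"] Q(2) Sc unfolding P_def by blast
    then show ?thesis unfolding P_def using Q.Icarr by blast
  qed
  ultimately have "minimal_primeideal P R" unfolding minimal_primeideal_def by blast
  then have "z \<in> P" by (rule minp)
  then show False using S(2) by (simp add: P_def)
qed

lemma (in cring) nilpotent_in_prime:
  assumes P: "primeideal P R" and a: "a \<in> carrier R" "a [^] (n::nat) = \<zero>"
  shows "a \<in> P"
proof -
  interpret P: primeideal P R by (rule P)
  have "a [^] m \<in> P \<Longrightarrow> a \<in> P" for m :: nat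
  proof (induction m)
    case 0
    then show ?case using P.I_notcarr P.one_imp_carrier by simp
  next
    case (Suc m)
    then show ?case using P.I_prime[of "a [^] m" a] a by auto
  qed
  then show ?thesis using a(2) P.zero_closed by metis
qed

section \<open>Homomorphisms and free modules of finite rank\<close>

lemma mod_homI:
  assumes "\<And>x. x \<in> carrier M \<Longrightarrow> f x \<in> carrier N"
    and "\<And>x y. x \<in> carrier M \<Longrightarrow> y \<in> carrier M \<Longrightarrow> f (x \<oplus>\<^bsub>M\<^esub> y) = f x \<oplus>\<^bsub>N\<^esub> f y"
    and "\<And>r x. r \<in> carrier R \<Longrightarrow> x \<in> carrier M \<Longrightarrow> f (r \<odot>\<^bsub>M\<^esub> x) = r \<odot>\<^bsub>N\<^esub> f x"
  shows "f \<in> mod_hom R M N"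
  using assms by (auto simp: mod_hom_def)

lemma mod_homD:
  assumes "f \<in> mod_hom R M N"
  shows mod_hom_closed: "x \<in> carrier M \<Longrightarrow> f x \<in> carrier N"
    and mod_hom_add: "x \<in> carrier M \<Longrightarrow> y \<in> carrier M \<Longrightarrow> f (x \<oplus>\<^bsub>M\<^esub> y) = f x \<oplus>\<^bsub>N\<^esub> f y"
    and mod_hom_smult: "r \<in> carrier R \<Longrightarrow> x \<in> carrier M \<Longrightarrow> f (r \<odot>\<^bsub>M\<^esub> x) = r \<odot>\<^bsub>N\<^esub> f x"
  using assms by (auto simp: mod_hom_def)

lemma mod_hom_zero:
  assumes f: "f \<in> mod_hom R M N" and M: "module R M" and N: "module R N"
  shows "f \<zero>\<^bsub>M\<^esub> = \<zero>\<^bsub>N\<^esub>"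
proof -
  interpret M: module R M by fact
  interpret N: module R N by fact
  have "f (\<zero>\<^bsub>R\<^esub> \<odot>\<^bsub>M\<^esub> \<zero>\<^bsub>M\<^esub>) = \<zero>\<^bsub>R\<^esub> \<odot>\<^bsub>N\<^esub> f \<zero>\<^bsub>M\<^esub>"
    using f by (intro mod_hom_smult) auto
  then show ?thesis using mod_hom_closed[OF f] by simp
qed

lemma mod_hom_minus:
  assumes f: "f \<in> mod_hom R M N" and M: "module R M" and N: "module R N"
    and x: "x \<in> carrier M" and y: "y \<in> carrier M"
  shows "f (x \<ominus>\<^bsub>M\<^esub> y) = f x \<ominus>\<^bsub>N\<^esub> f y"
proof -
  interpret M: module R M by fact
  interpret N: module R N by fact
  have "f (\<ominus>\<^bsub>M\<^esub> y) = f ((\<ominus>\<^bsub>R\<^esub> \<one>\<^bsub>R\<^esub>) \<odot>\<^bsub>M\<^esub> y)"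
    using y by (simp add: M.smult_l_minus)
  also have "\<dots> = \<ominus>\<^bsub>N\<^esub> f y"
    using y mod_hom_closed[OF f y] by (subst mod_hom_smult[OF f]) (simp_all add: N.smult_l_minus)
  finally show ?thesis
    using mod_hom_add[OF f x M.a_inv_closed[OF y]] by (simp add: a_minus_def)
qed

lemma mod_hom_comp:
  "f \<in> mod_hom R M N \<Longrightarrow> g \<in> mod_hom R N P \<Longrightarrow> g \<circ> f \<in> mod_hom R M P"
  by (rule mod_homI) (auto simp: mod_hom_closed mod_hom_add mod_hom_smult)

lemma mod_hom_id: "id \<in> mod_hom R M M"
  by (auto simp: mod_hom_def)

lemma mod_hom_funpow:
  "f \<in> mod_hom R M M \<Longrightarrow> f ^^ n \<in> mod_hom R M M"
  by (induction n) (simp_all add: mod_hom_id mod_hom_comp del: funpow.simps(2) add: funpow_Suc_right)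

lemma mod_hom_diff:
  assumes f: "f \<in> mod_hom R M N" and g: "g \<in> mod_hom R M N" and N: "module R N"
  shows "(\<lambda>x. f x \<ominus>\<^bsub>N\<^esub> g x) \<in> mod_hom R M N"
proof -
  interpret N: module R N by fact
  note cl = mod_hom_closed[OF f] mod_hom_closed[OF g]
  show ?thesis
  proof (rule mod_homI)
    fix x y assume xy: "x \<in> carrier M" "y \<in> carrier M"
    show "f (x \<oplus>\<^bsub>M\<^esub> y) \<ominus>\<^bsub>N\<^esub> g (x \<oplus>\<^bsub>M\<^esub> y) = f x \<ominus>\<^bsub>N\<^esub> g x \<oplus>\<^bsub>N\<^esub> (f y \<ominus>\<^bsub>N\<^esub> g y)"
      using xy cl by (simp add: mod_hom_add[OF f] mod_hom_add[OF g] N.minus_eq N.minus_add N.a_ac)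
  next
    fix r x assume "r \<in> carrier R" "x \<in> carrier M"
    then show "f (r \<odot>\<^bsub>M\<^esub> x) \<ominus>\<^bsub>N\<^esub> g (r \<odot>\<^bsub>M\<^esub> x) = r \<odot>\<^bsub>N\<^esub> (f x \<ominus>\<^bsub>N\<^esub> g x)"
      using cl by (simp add: mod_hom_smult[OF f] mod_hom_smult[OF g] N.minus_eq
          N.smult_r_distr N.smult_r_minus)
  qed (use cl in auto)
qed

lemma mod_hom_smult_map:
  assumes f: "f \<in> mod_hom R M N" and N: "module R N" and a: "a \<in> carrier R"
  shows "(\<lambda>x. a \<odot>\<^bsub>N\<^esub> f x) \<in> mod_hom R M N"
proof -
  interpret N: module R N by fact
  show ?thesis
  proof (rule mod_homI)
    fix r x assume "r \<in> carrier R" "x \<in> carrier M"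
    then show "a \<odot>\<^bsub>N\<^esub> f (r \<odot>\<^bsub>M\<^esub> x) = r \<odot>\<^bsub>N\<^esub> (a \<odot>\<^bsub>N\<^esub> f x)"
      using a mod_hom_closed[OF f]
      by (simp add: mod_hom_smult[OF f] N.smult_assoc1[symmetric] N.R.m_comm)
  qed (use a mod_hom_closed[OF f] in \<open>auto simp: mod_hom_add[OF f] N.smult_r_distr\<close>)
qed

lemma mod_hom_finsum:
  assumes f: "f \<in> mod_hom R M N" and M: "module R M" and N: "module R N"
    and "finite S" and "u \<in> S \<rightarrow> carrier M"
  shows "f (\<Oplus>\<^bsub>M\<^esub>i\<in>S. u i) = (\<Oplus>\<^bsub>N\<^esub>i\<in>S. f (u i))"
proof -
  interpret M: module R M by fact
  interpret N: module R N by fact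
  show ?thesis
    using assms(4,5)
  proof (induction S rule: finite_induct)
    case empty
    then show ?case by (simp add: mod_hom_zero[OF f M N])
  next
    case (insert k S)
    then have "f (\<Oplus>\<^bsub>M\<^esub>i\<in>insert k S. u i) = f (u k) \<oplus>\<^bsub>N\<^esub> f (\<Oplus>\<^bsub>M\<^esub>i\<in>S. u i)"
      by (simp add: Pi_def mod_hom_add[OF f])
    then show ?case
      using insert mod_hom_closed[OF f] by (simp add: Pi_def)
  qed
qed

definition free_mod :: "('a, 'r) ring_scheme \<Rightarrow> 'i set \<Rightarrow> ('a, 'i \<Rightarrow> 'a) module" where
  "free_mod R A = \<lparr>carrier = A \<rightarrow>\<^sub>E carrier R, monoid.mult = (\<lambda>x y. undefined), monoid.one = undefined,
     ring.zero = (\<lambda>i\<in>A. \<zero>\<^bsub>R\<^esub>), ring.add = (\<lambda>x y. \<lambda>i\<in>A. x i \<oplus>\<^bsub>R\<^esub> y i), smult = (\<lambda>r x. \<lambda>i\<in>A. r \<otimes>\<^bsub>R\<^esub> x i)\<rparr>"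

definition unit_fun :: "('a, 'r) ring_scheme \<Rightarrow> 'i set \<Rightarrow> 'i \<Rightarrow> 'i \<Rightarrow> 'a" where
  "unit_fun R A i = (\<lambda>j\<in>A. if i = j then \<one>\<^bsub>R\<^esub> else \<zero>\<^bsub>R\<^esub>)"

definition lin_comb ::
    "('a, 'm, 'c) module_scheme \<Rightarrow> 'i set \<Rightarrow> ('i \<Rightarrow> 'm) \<Rightarrow> ('i \<Rightarrow> 'a) \<Rightarrow> 'm" where
  "lin_comb M A u x = (\<Oplus>\<^bsub>M\<^esub>i\<in>A. x i \<odot>\<^bsub>M\<^esub> u i)"

lemma carrier_free_mod: "carrier (free_mod R A) = A \<rightarrow>\<^sub>E carrier R"
  and zero_free_mod: "\<zero>\<^bsub>free_mod R A\<^esub> = (\<lambda>i\<in>A. \<zero>\<^bsub>R\<^esub>)"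
  and add_free_mod: "x \<oplus>\<^bsub>free_mod R A\<^esub> y = (\<lambda>i\<in>A. x i \<oplus>\<^bsub>R\<^esub> y i)"
  and smult_free_mod: "r \<odot>\<^bsub>free_mod R A\<^esub> x = (\<lambda>i\<in>A. r \<otimes>\<^bsub>R\<^esub> x i)"
  by (simp_all add: free_mod_def)

lemmas free_mod_simps = carrier_free_mod zero_free_mod add_free_mod smult_free_mod

lemma free_mod_closed: "x \<in> carrier (free_mod R A) \<Longrightarrow> i \<in> A \<Longrightarrow> x i \<in> carrier R"
  by (auto simp: free_mod_simps)

lemma free_mod_eqI:
  assumes "x \<in> carrier (free_mod R A)" "y \<in> carrier (free_mod R A)" "\<And>i. i \<in> A \<Longrightarrow> x i = y i"
  shows "x = y"
  using assms by (auto simp: free_mod_simps intro: PiE_ext)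

lemma (in cring) module_free_mod: "module R (free_mod R A)"
proof (rule moduleI[OF cring_axioms])
  show "abelian_group (free_mod R A)"
  proof (rule abelian_groupI)
    fix x y z assume "x \<in> carrier (free_mod R A)" "y \<in> carrier (free_mod R A)" "z \<in> carrier (free_mod R A)"
    then show "x \<oplus>\<^bsub>free_mod R A\<^esub> y \<oplus>\<^bsub>free_mod R A\<^esub> z = x \<oplus>\<^bsub>free_mod R A\<^esub> (y \<oplus>\<^bsub>free_mod R A\<^esub> z)"
      by (auto simp: free_mod_simps PiE_iff a_assoc intro!: restrict_ext)
  next
    fix x assume "x \<in> carrier (free_mod R A)"
    then show "\<exists>y\<in>carrier (free_mod R A). y \<oplus>\<^bsub>free_mod R A\<^esub> x = \<zero>\<^bsub>free_mod R A\<^esub>"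
      by (intro bexI[of _ "\<lambda>i\<in>A. \<ominus> x i"]) (auto simp: free_mod_simps PiE_iff l_neg intro!: restrict_ext)
  next
    fix x assume x: "x \<in> carrier (free_mod R A)"
    then show "\<zero>\<^bsub>free_mod R A\<^esub> \<oplus>\<^bsub>free_mod R A\<^esub> x = x"
      by (intro free_mod_eqI[of _ R A]) (auto simp: free_mod_simps PiE_iff)
  qed (auto simp: free_mod_simps PiE_iff a_comm intro!: restrict_ext)
next
  fix x assume x: "x \<in> carrier (free_mod R A)"
  then show "\<one> \<odot>\<^bsub>free_mod R A\<^esub> x = x"
    by (intro free_mod_eqI[of _ R A]) (auto simp: free_mod_simps PiE_iff)
qed (auto simp: free_mod_simps PiE_iff l_distr r_distr m_assoc intro!: restrict_ext)

lemma (in cring) minus_free_mod: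
  assumes x: "x \<in> carrier (free_mod R A)" and y: "y \<in> carrier (free_mod R A)"
  shows "x \<ominus>\<^bsub>free_mod R A\<^esub> y = (\<lambda>i\<in>A. x i \<ominus> y i)"
proof -
  interpret F: module R "free_mod R A" by (rule module_free_mod)
  have "\<ominus>\<^bsub>free_mod R A\<^esub> y = (\<ominus> \<one>) \<odot>\<^bsub>free_mod R A\<^esub> y"
    using y by (simp add: F.smult_l_minus)
  then show ?thesis
    using x y by (auto simp: F.minus_eq minus_eq l_minus free_mod_simps PiE_iff intro!: restrict_ext)
qed

lemma (in cring) unit_fun_closed: "unit_fun R A i \<in> carrier (free_mod R A)"
  by (auto simp: unit_fun_def free_mod_simps)

lemma (in cring) finsum_free_mod:
  assumes "finite S" "u \<in> S \<rightarrow> carrier (free_mod R A)" "j \<in> A"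
  shows "(\<Oplus>\<^bsub>free_mod R A\<^esub>i\<in>S. u i) j = (\<Oplus>i\<in>S. u i j)"
proof -
  interpret F: module R "free_mod R A" by (rule module_free_mod)
  show ?thesis
    using assms(1,2)
  proof (induction S rule: finite_induct)
    case empty
    then show ?case using assms(3) by (simp add: zero_free_mod)
  next
    case (insert k S)
    then show ?case using assms(3) free_mod_closed[of _ R A j]
      by (simp add: Pi_def add_free_mod)
  qed
qed

lemma smult_free_mod_apply: "i \<in> A \<Longrightarrow> (r \<odot>\<^bsub>free_mod R A\<^esub> x) i = r \<otimes>\<^bsub>R\<^esub> x i"
  by (simp add: smult_free_mod)

lemma (in cring) minus_free_mod_apply:
  "x \<in> carrier (free_mod R A) \<Longrightarrow> y \<in> carrier (free_mod R A) \<Longrightarrow> i \<in> A \<Longrightarrow>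
    (x \<ominus>\<^bsub>free_mod R A\<^esub> y) i = x i \<ominus> y i"
  by (simp add: minus_free_mod)

lemma lin_comb_mod_hom:
  assumes M: "module R M" and fin: "finite A" and u: "u \<in> A \<rightarrow> carrier M"
  shows "lin_comb M A u \<in> mod_hom R (free_mod R A) M"
proof -
  interpret M: module R M by fact
  have ui: "u i \<in> carrier M" if "i \<in> A" for i using u that by auto
  show ?thesis
    unfolding lin_comb_def
  proof (rule mod_homI)
    fix x assume "x \<in> carrier (free_mod R A)"
    then show "(\<Oplus>\<^bsub>M\<^esub>i\<in>A. x i \<odot>\<^bsub>M\<^esub> u i) \<in> carrier M"
      using ui free_mod_closed by (intro M.finsum_closed) force
  next
    fix x y assume xy: "x \<in> carrier (free_mod R A)" "y \<in> carrier (free_mod R A)"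
    have "(\<Oplus>\<^bsub>M\<^esub>i\<in>A. (x \<oplus>\<^bsub>free_mod R A\<^esub> y) i \<odot>\<^bsub>M\<^esub> u i)
        = (\<Oplus>\<^bsub>M\<^esub>i\<in>A. x i \<odot>\<^bsub>M\<^esub> u i \<oplus>\<^bsub>M\<^esub> y i \<odot>\<^bsub>M\<^esub> u i)"
      by (rule M.finsum_cong')
        (use ui xy in \<open>auto simp: add_free_mod M.smult_l_distr free_mod_closed\<close>)
    also have "\<dots> = (\<Oplus>\<^bsub>M\<^esub>i\<in>A. x i \<odot>\<^bsub>M\<^esub> u i) \<oplus>\<^bsub>M\<^esub> (\<Oplus>\<^bsub>M\<^esub>i\<in>A. y i \<odot>\<^bsub>M\<^esub> u i)"
      by (rule M.finsum_addf) (use ui xy free_mod_closed in \<open>force+\<close>)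
    finally show "(\<Oplus>\<^bsub>M\<^esub>i\<in>A. (x \<oplus>\<^bsub>free_mod R A\<^esub> y) i \<odot>\<^bsub>M\<^esub> u i)
        = (\<Oplus>\<^bsub>M\<^esub>i\<in>A. x i \<odot>\<^bsub>M\<^esub> u i) \<oplus>\<^bsub>M\<^esub> (\<Oplus>\<^bsub>M\<^esub>i\<in>A. y i \<odot>\<^bsub>M\<^esub> u i)" .
  next
    fix r x assume rx: "r \<in> carrier R" "x \<in> carrier (free_mod R A)"
    have "(\<Oplus>\<^bsub>M\<^esub>i\<in>A. (r \<odot>\<^bsub>free_mod R A\<^esub> x) i \<odot>\<^bsub>M\<^esub> u i)
        = (\<Oplus>\<^bsub>M\<^esub>i\<in>A. r \<odot>\<^bsub>M\<^esub> (x i \<odot>\<^bsub>M\<^esub> u i))"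
      by (rule M.finsum_cong')
        (use ui rx in \<open>auto simp: smult_free_mod M.smult_assoc1 free_mod_closed\<close>)
    also have "\<dots> = r \<odot>\<^bsub>M\<^esub> (\<Oplus>\<^bsub>M\<^esub>i\<in>A. x i \<odot>\<^bsub>M\<^esub> u i)"
      by (rule M.finsum_smult_ldistr[symmetric]) (use ui rx fin free_mod_closed in \<open>force+\<close>)
    finally show "(\<Oplus>\<^bsub>M\<^esub>i\<in>A. (r \<odot>\<^bsub>free_mod R A\<^esub> x) i \<odot>\<^bsub>M\<^esub> u i)
        = r \<odot>\<^bsub>M\<^esub> (\<Oplus>\<^bsub>M\<^esub>i\<in>A. x i \<odot>\<^bsub>M\<^esub> u i)" .
  qed
qed

lemma lin_comb_unit_fun:
  assumes M: "module R M" and fin: "finite A" and u: "u \<in> A \<rightarrow> carrier M" and k: "k \<in> A"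
  shows "lin_comb M A u (unit_fun R A k) = u k"
proof -
  interpret M: module R M by fact
  have ui: "u i \<in> carrier M" if "i \<in> A" for i using u that by auto
  have "lin_comb M A u (unit_fun R A k) = (\<Oplus>\<^bsub>M\<^esub>i\<in>A. if k = i then u i else \<zero>\<^bsub>M\<^esub>)"
    unfolding lin_comb_def by (rule M.finsum_cong') (use ui in \<open>auto simp: unit_fun_def\<close>)
  then show ?thesis using M.finsum_singleton[OF k fin u] by simp
qed

lemma (in cring) lin_comb_unit_funs:
  assumes fin: "finite A" and x: "x \<in> carrier (free_mod R A)"
  shows "lin_comb (free_mod R A) A (unit_fun R A) x = x"
proof (rule free_mod_eqI[of _ R A])
  have e: "unit_fun R A \<in> A \<rightarrow> carrier (free_mod R A)" by (simp add: unit_fun_closed)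
  show "lin_comb (free_mod R A) A (unit_fun R A) x \<in> carrier (free_mod R A)"
    using mod_hom_closed[OF lin_comb_mod_hom[OF module_free_mod fin e] x] .
  fix j assume j: "j \<in> A"
  interpret F: module R "free_mod R A" by (rule module_free_mod)
  have xi: "x i \<in> carrier R" if "i \<in> A" for i using x that by (rule free_mod_closed)
  have "lin_comb (free_mod R A) A (unit_fun R A) x j = (\<Oplus>i\<in>A. (x i \<odot>\<^bsub>free_mod R A\<^esub> unit_fun R A i) j)"
    unfolding lin_comb_def
    by (rule finsum_free_mod) (use fin j xi e in auto)
  also have "\<dots> = (\<Oplus>i\<in>A. if j = i then x i else \<zero>)"
    by (rule finsum_cong') (use xi j in \<open>auto simp: smult_free_mod unit_fun_def\<close>)
  also have "\<dots> = x j" using finsum_singleton[OF j fin, of x] xi by simp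
  finally show "lin_comb (free_mod R A) A (unit_fun R A) x j = x j" .
qed (rule x)

lemma mod_hom_lin_comb:
  assumes f: "f \<in> mod_hom R M N" and M: "module R M" and N: "module R N"
    and fin: "finite A" and u: "u \<in> A \<rightarrow> carrier M" and x: "x \<in> carrier (free_mod R A)"
  shows "f (lin_comb M A u x) = lin_comb N A (f \<circ> u) x"
proof -
  interpret M: module R M by fact
  interpret N: module R N by fact
  have ui: "u i \<in> carrier M" if "i \<in> A" for i using u that by auto
  note xi = free_mod_closed[OF x]
  have "f (lin_comb M A u x) = (\<Oplus>\<^bsub>N\<^esub>i\<in>A. f (x i \<odot>\<^bsub>M\<^esub> u i))"
    unfolding lin_comb_def by (rule mod_hom_finsum[OF f M N fin]) (use ui xi in auto)
  also have "\<dots> = lin_comb N A (f \<circ> u) x"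
    unfolding lin_comb_def
    by (rule N.finsum_cong') (use ui xi mod_hom_closed[OF f] in \<open>auto simp: mod_hom_smult[OF f]\<close>)
  finally show ?thesis .
qed

lemma (in cring) mod_hom_free_mod_eq:
  assumes f: "f \<in> mod_hom R (free_mod R A) N" and N: "module R N" and fin: "finite A"
    and x: "x \<in> carrier (free_mod R A)"
  shows "f x = lin_comb N A (\<lambda>i. f (unit_fun R A i)) x"
  using mod_hom_lin_comb[OF f module_free_mod N fin _ x, of "unit_fun R A"]
    lin_comb_unit_funs[OF fin x] by (simp add: unit_fun_closed comp_def)

lemma (in cring) lin_comb_free_mod:
  assumes fin: "finite A" and u: "u \<in> A \<rightarrow> carrier (free_mod R B)"
    and x: "x \<in> carrier (free_mod R A)" and j: "j \<in> B"
  shows "lin_comb (free_mod R B) A u x j = (\<Oplus>i\<in>A. x i \<otimes> u i j)"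
proof -
  interpret F: module R "free_mod R B" by (rule module_free_mod)
  have uij: "u i j \<in> carrier R" if "i \<in> A" for i using u j that by (auto intro: free_mod_closed)
  note xi = free_mod_closed[OF x]
  have "lin_comb (free_mod R B) A u x j = (\<Oplus>i\<in>A. (x i \<odot>\<^bsub>free_mod R B\<^esub> u i) j)"
    unfolding lin_comb_def by (rule finsum_free_mod) (use fin j xi u in auto)
  also have "\<dots> = (\<Oplus>i\<in>A. x i \<otimes> u i j)"
    by (rule finsum_cong') (use xi j uij in \<open>auto simp: smult_free_mod\<close>)
  finally show ?thesis .
qed

section \<open>The equational criterion for flatness\<close>

lemma submodule_image_mod_hom:
  assumes f: "f \<in> mod_hom R M N" and M: "module R M" and N: "module R N"
  shows "submodule (f ` carrier M) R N"
proof -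
  interpret M: module R M by fact
  interpret N: module R N by fact
  show ?thesis
  proof (rule N.submoduleI)
    show "f ` carrier M \<subseteq> carrier N" using mod_hom_closed[OF f] by blast
    show "\<zero>\<^bsub>N\<^esub> \<in> f ` carrier M" using mod_hom_zero[OF f M N] by force
    show "a \<oplus>\<^bsub>N\<^esub> b \<in> f ` carrier M" if "a \<in> f ` carrier M" "b \<in> f ` carrier M" for a b
      using that by (auto simp: mod_hom_add[OF f, symmetric])
    show sm: "r \<odot>\<^bsub>N\<^esub> a \<in> f ` carrier M" if "r \<in> carrier R" "a \<in> f ` carrier M" for r a
      using that by (auto simp: mod_hom_smult[OF f, symmetric])
    show "\<ominus>\<^bsub>N\<^esub> a \<in> f ` carrier M" if a: "a \<in> f ` carrier M" for a
    proof -
      have "a \<in> carrier N" using a mod_hom_closed[OF f] by blast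
      then have "\<ominus>\<^bsub>N\<^esub> a = (\<ominus>\<^bsub>R\<^esub> \<one>\<^bsub>R\<^esub>) \<odot>\<^bsub>N\<^esub> a" by (simp add: N.smult_l_minus)
      then show ?thesis using sm[OF _ a] by simp
    qed
  qed
qed

text \<open>A copy of \<open>R\<close> as a module over itself whose carrier has the type required of test modules.\<close>

definition nat_fun_module :: "('a, 'r) ring_scheme \<Rightarrow> ('a, (nat \<Rightarrow> 'a) set) module" where
  "nat_fun_module R =
     (let e = (\<lambda>r. {\<lambda>_. r}); d = inv_into UNIV e in
     \<lparr>carrier = e ` carrier R, monoid.mult = (\<lambda>x y. undefined), monoid.one = undefined,
      ring.zero = e \<zero>\<^bsub>R\<^esub>, ring.add = (\<lambda>x y. e (d x \<oplus>\<^bsub>R\<^esub> d y)), smult = (\<lambda>r x. e (r \<otimes>\<^bsub>R\<^esub> d x))\<rparr>)"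

lemma inv_singleton_const: "inv_into UNIV (\<lambda>r. {\<lambda>_. r}) {\<lambda>_. r} = r"
proof -
  have "inj (\<lambda>r. {\<lambda>_. r})" by (auto simp: inj_on_def fun_eq_iff)
  then show ?thesis by (rule inv_f_f)
qed

lemma carrier_nat_fun_module: "carrier (nat_fun_module R) = (\<lambda>r. {\<lambda>_. r}) ` carrier R"
  and zero_nat_fun_module: "\<zero>\<^bsub>nat_fun_module R\<^esub> = {\<lambda>_. \<zero>\<^bsub>R\<^esub>}"
  and add_nat_fun_module: "{\<lambda>_. r} \<oplus>\<^bsub>nat_fun_module R\<^esub> {\<lambda>_. s} = {\<lambda>_. r \<oplus>\<^bsub>R\<^esub> s}"
  and smult_nat_fun_module: "r \<odot>\<^bsub>nat_fun_module R\<^esub> {\<lambda>_. s} = {\<lambda>_. r \<otimes>\<^bsub>R\<^esub> s}"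
  by (simp_all add: nat_fun_module_def Let_def inv_singleton_const)

lemmas nat_fun_module_simps = carrier_nat_fun_module zero_nat_fun_module
  add_nat_fun_module smult_nat_fun_module

lemma (in cring) module_nat_fun_module: "module R (nat_fun_module R)"
proof (rule moduleI[OF cring_axioms])
  show "abelian_group (nat_fun_module R)"
  proof (rule abelian_groupI)
    fix x assume "x \<in> carrier (nat_fun_module R)"
    then obtain r where "x = {\<lambda>_. r}" "r \<in> carrier R" by (auto simp: nat_fun_module_simps)
    then show "\<exists>y\<in>carrier (nat_fun_module R). y \<oplus>\<^bsub>nat_fun_module R\<^esub> x = \<zero>\<^bsub>nat_fun_module R\<^esub>"
      by (intro bexI[of _ "{\<lambda>_. \<ominus> r}"]) (auto simp: nat_fun_module_simps l_neg)
  qed (auto simp: nat_fun_module_simps a_ac)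
qed (auto simp: nat_fun_module_simps l_distr r_distr m_assoc)

lemma (in cring) lin_comb_nat_fun_module:
  assumes fin: "finite A" and x: "x \<in> A \<rightarrow> carrier R" and y: "y \<in> A \<rightarrow> carrier R"
  shows "lin_comb (nat_fun_module R) A (\<lambda>i. {\<lambda>_. x i}) y = {\<lambda>_. \<Oplus>i\<in>A. y i \<otimes> x i}"
proof -
  interpret N: module R "nat_fun_module R" by (rule module_nat_fun_module)
  show ?thesis
    using fin x y unfolding lin_comb_def
  proof (induction A rule: finite_induct)
    case empty
    then show ?case by (simp add: nat_fun_module_simps)
  next
    case (insert k S)
    have "(\<lambda>i. y i \<odot>\<^bsub>nat_fun_module R\<^esub> {\<lambda>_. x i}) \<in> S \<rightarrow> carrier (nat_fun_module R)"
      using insert.prems by (auto simp: nat_fun_module_simps)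
    moreover have "(\<lambda>i. y i \<otimes> x i) \<in> S \<rightarrow> carrier R" using insert.prems by auto
    moreover have "y k \<odot>\<^bsub>nat_fun_module R\<^esub> {\<lambda>_. x k} \<in> carrier (nat_fun_module R)" "y k \<otimes> x k \<in> carrier R"
      using insert.prems by (auto simp: nat_fun_module_simps)
    ultimately show ?case
      using insert by (simp add: nat_fun_module_simps)
  qed
qed

context
  fixes R :: "('a, 'r) ring_scheme" and M :: "('a, 'm, 'c) module_scheme"
    and N :: "('a, 'n, 'd) module_scheme"
  assumes M: "module R M" and N: "module R N"
begin

lemma tensor_rel_group_zero: "0 \<in> tensor_rel_group R M N"
  using subgroup.one_closed[OF subgroup_tensor_rel_group[OF M N]] by simp

lemma tensor_rel_group_add:
  "a \<in> tensor_rel_group R M N \<Longrightarrow> b \<in> tensor_rel_group R M N \<Longrightarrow> a + b \<in> tensor_rel_group R M N"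
  using subgroup.m_closed[OF subgroup_tensor_rel_group[OF M N]] by simp

lemma tensor_rel_group_keys:
  "a \<in> tensor_rel_group R M N \<Longrightarrow> Poly_Mapping.keys a \<subseteq> carrier M \<times> carrier N"
  using subsetD[OF subgroup.subset[OF subgroup_tensor_rel_group[OF M N]]] by simp

lemma tensor_rel_group_diff:
  assumes "a \<in> tensor_rel_group R M N" "b \<in> tensor_rel_group R M N"
  shows "a - b \<in> tensor_rel_group R M N"
proof -
  have "- b \<in> tensor_rel_group R M N"
    using subgroup.m_inv_closed[OF subgroup_tensor_rel_group[OF M N] assms(2)]
      tensor_rel_group_keys[OF assms(2)] by simp
  then show ?thesis using tensor_rel_group_add[OF assms(1)] by fastforce
qed

lemma tensor_rel_group_incl: "a \<in> tensor_rels R M N \<Longrightarrow> a \<in> tensor_rel_group R M N"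
  unfolding tensor_rel_group_def by (rule generate.incl)

lemma tensor_rel_group_add_left:
  assumes "x \<in> carrier M" "x' \<in> carrier M" "y \<in> carrier N"
  shows "frag_of (x \<oplus>\<^bsub>M\<^esub> x', y) - frag_of (x, y) - frag_of (x', y) \<in> tensor_rel_group R M N"
  by (rule tensor_rel_group_incl) (use assms in \<open>unfold tensor_rels_def, blast\<close>)

lemma tensor_rel_group_smult:
  assumes "x \<in> carrier M" "r \<in> carrier R" "y \<in> carrier N"
  shows "frag_of (r \<odot>\<^bsub>M\<^esub> x, y) - frag_of (x, r \<odot>\<^bsub>N\<^esub> y) \<in> tensor_rel_group R M N"
  by (rule tensor_rel_group_incl) (use assms in \<open>unfold tensor_rels_def, blast\<close>)

lemma tensor_rel_group_zero_left:
  assumes "y \<in> carrier N"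
  shows "frag_of (\<zero>\<^bsub>M\<^esub>, y) \<in> tensor_rel_group R M N"
proof -
  interpret M: module R M by (rule M)
  have "0 - (frag_of (\<zero>\<^bsub>M\<^esub> \<oplus>\<^bsub>M\<^esub> \<zero>\<^bsub>M\<^esub>, y) - frag_of (\<zero>\<^bsub>M\<^esub>, y) - frag_of (\<zero>\<^bsub>M\<^esub>, y)) \<in> tensor_rel_group R M N"
    by (intro tensor_rel_group_diff tensor_rel_group_zero tensor_rel_group_add_left) (use assms in auto)
  then show ?thesis by simp
qed

lemma tensor_rel_group_sum:
  assumes "finite A" and "g \<in> A \<rightarrow> carrier M" and "x \<in> A \<rightarrow> carrier R" and y: "y \<in> carrier N"
  shows "(\<Sum>i\<in>A. frag_of (g i, x i \<odot>\<^bsub>N\<^esub> y)) - frag_of (lin_comb M A g x, y) \<in> tensor_rel_group R M N"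
  using assms(1-3)
proof (induction A rule: finite_induct)
  case empty
  interpret M: module R M by (rule M)
  show ?case
    using tensor_rel_group_diff[OF tensor_rel_group_zero tensor_rel_group_zero_left[OF y]]
    by (simp add: lin_comb_def)
next
  case (insert k A)
  interpret M: module R M by (rule M)
  define m where "m = lin_comb M A g x"
  define S where "S = (\<Sum>i\<in>A. frag_of (g i, x i \<odot>\<^bsub>N\<^esub> y))"
  have gx: "g k \<in> carrier M" "x k \<in> carrier R" and cl: "(\<lambda>i. x i \<odot>\<^bsub>M\<^esub> g i) \<in> A \<rightarrow> carrier M"
    using insert.prems by auto
  then have m: "m \<in> carrier M"
    unfolding m_def lin_comb_def by (intro M.finsum_closed)
  have "lin_comb M (insert k A) g x = x k \<odot>\<^bsub>M\<^esub> g k \<oplus>\<^bsub>M\<^esub> m"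
    unfolding m_def lin_comb_def using insert.hyps gx cl by simp
  moreover have "S - frag_of (m, y)
      - (frag_of (x k \<odot>\<^bsub>M\<^esub> g k \<oplus>\<^bsub>M\<^esub> m, y) - frag_of (x k \<odot>\<^bsub>M\<^esub> g k, y) - frag_of (m, y))
      - (frag_of (x k \<odot>\<^bsub>M\<^esub> g k, y) - frag_of (g k, x k \<odot>\<^bsub>N\<^esub> y)) \<in> tensor_rel_group R M N"
    using insert.IH insert.prems
    by (intro tensor_rel_group_diff[OF tensor_rel_group_diff[OF _ tensor_rel_group_add_left]
          tensor_rel_group_smult]) (use gx m y in \<open>auto simp: S_def m_def\<close>)
  moreover have "(\<Sum>i\<in>insert k A. frag_of (g i, x i \<odot>\<^bsub>N\<^esub> y)) = frag_of (g k, x k \<odot>\<^bsub>N\<^esub> y) + S"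
    unfolding S_def using insert.hyps by simp
  ultimately show ?case by (simp add: algebra_simps)
qed

end

lemma tensor_rel_group_if_map_in_tensor_rel_group:
  assumes M: "module R M" and N: "module R N" and N': "module R N'" and f: "f \<in> mod_hom R N N'"
    and inj: "inj_on (tensor_map R M N N' f) (carrier (tensor_product R M N))"
    and c: "Poly_Mapping.keys c \<subseteq> carrier M \<times> carrier N"
    and fc: "frag_extend (\<lambda>(x, y). frag_of (x, f y)) c \<in> tensor_rel_group R M N'"
  shows "c \<in> tensor_rel_group R M N"
proof -
  let ?G = "free_Abelian_group (carrier M \<times> carrier N)"
  let ?G' = "free_Abelian_group (carrier M \<times> carrier N')"
  let ?J = "tensor_rel_group R M N" and ?J' = "tensor_rel_group R M N'"
  note J = subgroup_tensor_rel_group[OF M N] and J' = subgroup_tensor_rel_group[OF M N']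
  have rc: "?J #>\<^bsub>?G\<^esub> d \<in> carrier (tensor_product R M N)" if "Poly_Mapping.keys d \<subseteq> carrier M \<times> carrier N" for d
    using group.rcosetsI[OF group_free_Abelian_group subgroup.subset[OF J]] that
    by (simp add: tensor_product_def FactGroup_def)
  have "tensor_map R M N N' f (?J #>\<^bsub>?G\<^esub> c) = ?J'"
    unfolding tensor_map_coset[OF M N N' f c]
    using subgroup.rcos_const[OF J' group_free_Abelian_group fc] .
  moreover have "tensor_map R M N N' f (?J #>\<^bsub>?G\<^esub> 0) = ?J'"
    using tensor_map_coset[OF M N N' f, of 0]
      subgroup.rcos_const[OF J' group_free_Abelian_group tensor_rel_group_zero[OF M N']] by simp
  ultimately have "?J #>\<^bsub>?G\<^esub> c = ?J #>\<^bsub>?G\<^esub> 0"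
    using inj_onD[OF inj _ rc[OF c] rc[of 0]] by simp
  also have "\<dots> = ?J" using subgroup.rcos_const[OF J group_free_Abelian_group tensor_rel_group_zero[OF M N]] .
  finally show ?thesis
    using group.rcos_self[OF group_free_Abelian_group _ J, of c] c by simp
qed

lemma group_product_add_monoid:
  assumes "abelian_group M"
  shows "comm_group (product_group A (\<lambda>_. add_monoid M))"
proof -
  interpret M: abelian_group M by fact
  show ?thesis
    by (rule group.group_comm_groupI[OF product_group])
      (auto simp: M.add.is_group M.a_comm PiE_iff intro!: restrict_ext)
qed

text \<open>The elements that die in the tensor product are detected by lifting the second factor along
  \<^term>\<open>lin_comb N' A u\<close> to the free module, which is possible modulo relations of \<^term>\<open>u\<close>.\<close>

lemma flat_module_relation:
  fixes R :: "('a, 'r) ring_scheme" and M :: "('a, 'm, 'c) module_scheme"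
    and N' :: "('a, (nat \<Rightarrow> 'a) set) module"
  assumes flat: "flat_module R M" and N': "module R N'" and fin: "finite A"
    and g: "g \<in> A \<rightarrow> carrier M" and gen: "lin_comb M A g ` carrier (free_mod R A) = carrier M"
    and x: "x \<in> carrier (free_mod R A)" and x0: "lin_comb M A g x = \<zero>\<^bsub>M\<^esub>"
    and e: "e \<in> carrier N'"
  defines "u \<equiv> \<lambda>i. x i \<odot>\<^bsub>N'\<^esub> e"
  shows "\<exists>c\<in>A \<rightarrow> carrier (free_mod R A). (\<forall>i\<in>A. lin_comb M A g (c i) = g i) \<and>
    (\<forall>j\<in>A. lin_comb N' A u (\<lambda>i\<in>A. c i j) = \<zero>\<^bsub>N'\<^esub>)"
proof -
  have M: "module R M" using flat by (simp add: flat_module_def)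
  interpret M: module R M by (rule M)
  interpret N': module R N' by (rule N')
  define F where "F = free_mod R A"
  have Fm: "module R F" unfolding F_def by (rule M.R.module_free_mod)
  interpret F: module R F by (rule Fm)
  note xi = free_mod_closed[OF x]
  have u: "u \<in> A \<rightarrow> carrier N'" using xi e by (auto simp: u_def)
  define \<phi> where "\<phi> = lin_comb N' A u"
  define \<mu> where "\<mu> = lin_comb M A g"
  have \<phi>: "\<phi> \<in> mod_hom R F N'" unfolding \<phi>_def F_def by (rule lin_comb_mod_hom[OF N' fin u])
  have \<mu>: "\<mu> \<in> mod_hom R F M" unfolding \<mu>_def F_def by (rule lin_comb_mod_hom[OF M fin g])
  define N where "N = N'\<lparr>carrier := \<phi> ` carrier F\<rparr>"
  have N: "module R N"
    unfolding N_def by (rule submodule.submodule_is_module[OF submodule_image_mod_hom[OF \<phi> Fm N'] N'])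
  have Ncar: "carrier N = \<phi> ` carrier F" and Nsub: "carrier N \<subseteq> carrier N'"
    using mod_hom_closed[OF \<phi>] by (auto simp: N_def)
  have Nop: "y \<oplus>\<^bsub>N\<^esub> z = y \<oplus>\<^bsub>N'\<^esub> z" "r \<odot>\<^bsub>N\<^esub> y = r \<odot>\<^bsub>N'\<^esub> y" for y z r
    by (simp_all add: N_def)
  have idN: "id \<in> mod_hom R N N'"
    by (rule mod_homI) (use Nsub in \<open>auto simp: Nop\<close>)
  have inj: "inj_on (tensor_map R M N N' id) (carrier (tensor_product R M N))"
    using flat N N' idN unfolding flat_module_def by (metis inj_on_id)
  define unit where "unit = unit_fun R A"
  have unit: "unit i \<in> carrier F" for i unfolding unit_def F_def by (rule M.R.unit_fun_closed)
  have \<phi>unit: "\<phi> (unit i) = u i" and \<mu>unit: "\<mu> (unit i) = g i" if "i \<in> A" for i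
    unfolding \<phi>_def \<mu>_def unit_def
    using lin_comb_unit_fun[OF N' fin u that] lin_comb_unit_fun[OF M fin g that] by auto
  have uN: "u i \<in> carrier N" if "i \<in> A" for i using \<phi>unit[OF that] unit Ncar by (metis imageI)
  have gi: "g i \<in> carrier M" if "i \<in> A" for i using g that by auto
  define C where "C S = (\<Sum>i\<in>S. frag_of (g i, u i))" for S
  have keysC: "Poly_Mapping.keys (C S) \<subseteq> carrier M \<times> carrier N" if "S \<subseteq> A" for S
    using sum_closed_free_Abelian_group[of S "\<lambda>i. frag_of (g i, u i)" "carrier M \<times> carrier N"] that gi uN
    unfolding C_def by auto
  have "C A - frag_of (lin_comb M A g x, e) \<in> tensor_rel_group R M N'"
    unfolding C_def u_def by (rule tensor_rel_group_sum[OF M N' fin g _ e]) (use xi in auto)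
  from tensor_rel_group_add[OF M N' this, of "frag_of (\<zero>\<^bsub>M\<^esub>, e)"]
  have "C A \<in> tensor_rel_group R M N'"
    using tensor_rel_group_zero_left[OF M N' e] by (simp add: x0)
  moreover have "frag_extend (\<lambda>(x, y). frag_of (x, id y)) (C A) = C A"
    unfolding C_def using fin by (simp add: frag_extend_sum)
  ultimately have CA: "C A \<in> tensor_rel_group R M N"
    using tensor_rel_group_if_map_in_tensor_rel_group[OF M N N' idN inj keysC] by simp

  have "\<forall>z\<in>carrier N. \<exists>y\<in>carrier F. \<phi> y = z" using Ncar by auto
  then obtain l where l: "\<And>z. z \<in> carrier N \<Longrightarrow> l z \<in> carrier F" "\<And>z. z \<in> carrier N \<Longrightarrow> \<phi> (l z) = z"
    by metis
  have li: "l z i \<in> carrier R" if "z \<in> carrier N" "i \<in> A" for z i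
    using free_mod_closed[of "l z" R A i] l(1)[OF that(1)] that(2) by (simp add: F_def)
  define G where "G = product_group A (\<lambda>_. add_monoid M)"
  interpret G: comm_group G unfolding G_def by (rule group_product_add_monoid) unfold_locales
  have Gc: "carrier G = A \<rightarrow>\<^sub>E carrier M" and Gm: "\<And>v w. v \<otimes>\<^bsub>G\<^esub> w = (\<lambda>i\<in>A. v i \<oplus>\<^bsub>M\<^esub> w i)"
    and G1: "\<one>\<^bsub>G\<^esub> = (\<lambda>i\<in>A. \<zero>\<^bsub>M\<^esub>)"
    by (auto simp: G_def)
  have Ginv: "inv\<^bsub>G\<^esub> w = (\<lambda>i\<in>A. \<ominus>\<^bsub>M\<^esub> w i)" if "w \<in> carrier G" for w
    using inv_product_group[of w A "\<lambda>_. add_monoid M"] that M.add.is_group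
    unfolding G_def by (simp add: a_inv_def)
  let ?S = "carrier M \<times> carrier N"
  let ?FG = "free_Abelian_group ?S"
  have "(\<lambda>(y, z). \<lambda>i\<in>A. l z i \<odot>\<^bsub>M\<^esub> y) ` ?S \<subseteq> carrier G"
    using li by (auto simp: Gc)
  then obtain h where h: "h \<in> hom ?FG G"
    and hof: "\<And>p. p \<in> ?S \<Longrightarrow> h (frag_of p) = (\<lambda>(y, z). \<lambda>i\<in>A. l z i \<odot>\<^bsub>M\<^esub> y) p"
    using G.free_Abelian_group_universal by blast
  interpret h: group_hom ?FG G h
    using h by (simp add: group_hom_def group_hom_axioms_def)
  have hdiff: "h (a - b) = (\<lambda>i\<in>A. h a i \<ominus>\<^bsub>M\<^esub> h b i)"
    if ab: "Poly_Mapping.keys a \<subseteq> ?S" "Poly_Mapping.keys b \<subseteq> ?S" for a b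
  proof -
    have "h (- b) = inv\<^bsub>G\<^esub> h b" using h.hom_inv[of b] ab by simp
    moreover have "h (a \<otimes>\<^bsub>?FG\<^esub> (- b)) = h a \<otimes>\<^bsub>G\<^esub> h (- b)"
      by (rule h.hom_mult) (use ab in auto)
    ultimately have "h (a - b) = h a \<otimes>\<^bsub>G\<^esub> inv\<^bsub>G\<^esub> h b" by simp
    then show ?thesis
      using ab h.hom_closed[of b] by (simp add: Gm Ginv M.minus_eq cong: restrict_cong)
  qed

  define W where "W = {w \<in> carrier G. \<exists>c\<in>A \<rightarrow> carrier F. (\<forall>i\<in>A. w i = \<mu> (c i)) \<and>
    (\<forall>j\<in>A. \<phi> (\<lambda>i\<in>A. c i j) = \<zero>\<^bsub>N'\<^esub>)}"
  have colF: "(\<lambda>i\<in>A. c i j) \<in> carrier F" if "c \<in> A \<rightarrow> carrier F" "j \<in> A" for c j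
    using that free_mod_closed[of _ R A j] by (auto simp: F_def carrier_free_mod)
  have Wq: "(\<lambda>i\<in>A. q i \<odot>\<^bsub>M\<^esub> y) \<in> W" if q: "q \<in> carrier F" "\<phi> q = \<zero>\<^bsub>N'\<^esub>" and y: "y \<in> carrier M" for q y
  proof -
    obtain v where v: "v \<in> carrier F" "\<mu> v = y" using gen y unfolding \<mu>_def F_def by (metis imageE)
    have qi: "q i \<in> carrier R" and vi: "v i \<in> carrier R" if "i \<in> A" for i
      using free_mod_closed that q v unfolding F_def by auto
    have "\<phi> (\<lambda>i\<in>A. (q i \<odot>\<^bsub>F\<^esub> v) j) = \<zero>\<^bsub>N'\<^esub>" if j: "j \<in> A" for j
    proof -
      have "(\<lambda>i\<in>A. (q i \<odot>\<^bsub>F\<^esub> v) j) = v j \<odot>\<^bsub>F\<^esub> q"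
        using j qi vi unfolding F_def by (auto simp: smult_free_mod M.R.m_comm intro!: restrict_ext)
      then show ?thesis using mod_hom_smult[OF \<phi> vi[OF j] q(1)] q(2) vi[OF j] by simp
    qed
    moreover have "q i \<odot>\<^bsub>M\<^esub> y = \<mu> (q i \<odot>\<^bsub>F\<^esub> v)" if "i \<in> A" for i
      using mod_hom_smult[OF \<mu> qi[OF that] v(1)] v(2) by simp
    ultimately show ?thesis
      unfolding W_def Gc using y qi v(1)
      by (intro CollectI conjI bexI[of _ "\<lambda>i. q i \<odot>\<^bsub>F\<^esub> v"]) auto
  qed
  have W1: "\<one>\<^bsub>G\<^esub> \<in> W"
  proof -
    have "(\<lambda>i\<in>A. \<zero>\<^bsub>F\<^esub> i \<odot>\<^bsub>M\<^esub> \<zero>\<^bsub>M\<^esub>) \<in> W"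
      by (rule Wq) (use mod_hom_zero[OF \<phi> Fm N'] in auto)
    then show ?thesis unfolding G1 by (simp add: F_def zero_free_mod cong: restrict_cong)
  qed
  have Wdiff: "(\<lambda>i\<in>A. v i \<ominus>\<^bsub>M\<^esub> w i) \<in> W" if vw: "v \<in> W" "w \<in> W" for v w
  proof -
    obtain c d where c: "c \<in> A \<rightarrow> carrier F" "\<And>i. i \<in> A \<Longrightarrow> v i = \<mu> (c i)" "\<And>j. j \<in> A \<Longrightarrow> \<phi> (\<lambda>i\<in>A. c i j) = \<zero>\<^bsub>N'\<^esub>"
      and d: "d \<in> A \<rightarrow> carrier F" "\<And>i. i \<in> A \<Longrightarrow> w i = \<mu> (d i)" "\<And>j. j \<in> A \<Longrightarrow> \<phi> (\<lambda>i\<in>A. d i j) = \<zero>\<^bsub>N'\<^esub>"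
      using vw unfolding W_def by auto
    have ci: "c i \<in> carrier F" and di: "d i \<in> carrier F" if "i \<in> A" for i using c(1) d(1) that by auto
    have "\<phi> (\<lambda>i\<in>A. (c i \<ominus>\<^bsub>F\<^esub> d i) j) = \<zero>\<^bsub>N'\<^esub>" if j: "j \<in> A" for j
    proof -
      have "(\<lambda>i\<in>A. (c i \<ominus>\<^bsub>F\<^esub> d i) j) = (\<lambda>i\<in>A. c i j) \<ominus>\<^bsub>F\<^esub> (\<lambda>i\<in>A. d i j)"
        using j ci di colF[OF c(1) j] colF[OF d(1) j] unfolding F_def
        by (auto simp: M.R.minus_free_mod intro!: restrict_ext)
      then show ?thesis
        using mod_hom_minus[OF \<phi> Fm N' colF[OF c(1) j] colF[OF d(1) j]] c(3)[OF j] d(3)[OF j]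
        by (simp add: N'.minus_eq)
    qed
    moreover have "v i \<ominus>\<^bsub>M\<^esub> w i = \<mu> (c i \<ominus>\<^bsub>F\<^esub> d i)" if "i \<in> A" for i
      using mod_hom_minus[OF \<mu> Fm M ci[OF that] di[OF that]] c(2)[OF that] d(2)[OF that] by simp
    moreover have "(\<lambda>i\<in>A. v i \<ominus>\<^bsub>M\<^esub> w i) \<in> carrier G" using vw unfolding W_def Gc by auto
    ultimately show ?thesis
      unfolding W_def using ci di
      by (intro CollectI conjI bexI[of _ "\<lambda>i. c i \<ominus>\<^bsub>F\<^esub> d i"]) auto
  qed
  have WG: "W \<subseteq> carrier G" by (auto simp: W_def)
  have Winv: "inv\<^bsub>G\<^esub> w \<in> W" if "w \<in> W" for w
    using Wdiff[OF W1 that] Ginv[of w] that WG unfolding G1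
    by (auto simp: M.minus_eq Gc PiE_iff cong: restrict_cong)
  have Wmult: "v \<otimes>\<^bsub>G\<^esub> w \<in> W" if "v \<in> W" "w \<in> W" for v w
    using Wdiff[OF that(1) Winv[OF that(2)]] Ginv[of w] that WG
    by (auto simp: M.minus_eq Gc Gm PiE_iff cong: restrict_cong)
  have hrel: "h r \<in> W" if r: "r \<in> tensor_rels R M N" for r
  proof -
    have d: "Poly_Mapping.keys (a - b) \<subseteq> ?S"
      if "Poly_Mapping.keys a \<subseteq> ?S" "Poly_Mapping.keys b \<subseteq> ?S" for a b
      using that keys_diff[of a b] by blast
    interpret N: module R N by (rule N)
    from r show ?thesis
      unfolding tensor_rels_def
    proof (elim UnE CollectE exE conjE, goal_cases)
      case (1 y y' z)
      note left = 1(2-4) 1(1)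
      have "h r = (\<lambda>i\<in>A. l z i \<odot>\<^bsub>M\<^esub> (y \<oplus>\<^bsub>M\<^esub> y') \<ominus>\<^bsub>M\<^esub> l z i \<odot>\<^bsub>M\<^esub> y \<ominus>\<^bsub>M\<^esub> l z i \<odot>\<^bsub>M\<^esub> y')"
        unfolding left(4) using left
        by (auto simp: hdiff d hof intro!: restrict_ext)
      also have "\<dots> = \<one>\<^bsub>G\<^esub>"
        unfolding G1 using left li
        by (auto simp: M.smult_r_distr M.minus_eq M.a_ac M.r_neg1 M.r_neg intro!: restrict_ext)
      finally show ?thesis using W1 by simp
    next
      case (2 y z z')
      note right = 2(2-4) 2(1)
      let ?q = "l (z \<oplus>\<^bsub>N\<^esub> z') \<ominus>\<^bsub>F\<^esub> l z \<ominus>\<^bsub>F\<^esub> l z'"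
      have lF: "l (z \<oplus>\<^bsub>N\<^esub> z') \<in> carrier F" "l z \<in> carrier F" "l z' \<in> carrier F"
        using right l(1) by auto
      have zN: "z \<in> carrier N'" "z' \<in> carrier N'" using right Nsub by auto
      have "\<phi> ?q = (z \<oplus>\<^bsub>N\<^esub> z') \<ominus>\<^bsub>N'\<^esub> z \<ominus>\<^bsub>N'\<^esub> z'"
        using lF right l(2) by (simp add: mod_hom_minus[OF \<phi> Fm N'])
      then have "\<phi> ?q = \<zero>\<^bsub>N'\<^esub>"
        using zN by (simp add: Nop N'.minus_eq N'.a_ac N'.r_neg1 N'.r_neg)
      then have "(\<lambda>i\<in>A. ?q i \<odot>\<^bsub>M\<^esub> y) \<in> W" using Wq lF right(1) by simp
      moreover have "?q = (\<lambda>i\<in>A. l (z \<oplus>\<^bsub>N\<^esub> z') i \<ominus>\<^bsub>R\<^esub> l z i \<ominus>\<^bsub>R\<^esub> l z' i)"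
        using lF F.minus_closed unfolding F_def
        by (simp add: M.R.minus_free_mod cong: restrict_cong)
      moreover have "h r = (\<lambda>i\<in>A. l (z \<oplus>\<^bsub>N\<^esub> z') i \<odot>\<^bsub>M\<^esub> y \<ominus>\<^bsub>M\<^esub> l z i \<odot>\<^bsub>M\<^esub> y \<ominus>\<^bsub>M\<^esub> l z' i \<odot>\<^bsub>M\<^esub> y)"
        unfolding right(4) using right
        by (auto simp: hdiff d hof intro!: restrict_ext)
      ultimately show ?thesis
        using right li
        by (simp add: M.minus_eq M.R.minus_eq M.smult_l_distr M.smult_l_minus cong: restrict_cong)
    next
      case (3 s y z)
      note scalar = 3(2-4) 3(1)
      let ?q = "s \<odot>\<^bsub>F\<^esub> l z \<ominus>\<^bsub>F\<^esub> l (s \<odot>\<^bsub>N\<^esub> z)"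
      have lF: "l (s \<odot>\<^bsub>N\<^esub> z) \<in> carrier F" "l z \<in> carrier F"
        using scalar l(1) by auto
      have zN: "z \<in> carrier N'" using scalar Nsub by auto
      have "\<phi> ?q = s \<odot>\<^bsub>N'\<^esub> z \<ominus>\<^bsub>N'\<^esub> s \<odot>\<^bsub>N\<^esub> z"
        using lF scalar l(2) by (simp add: mod_hom_minus[OF \<phi> Fm N'] mod_hom_smult[OF \<phi>])
      then have "\<phi> ?q = \<zero>\<^bsub>N'\<^esub>"
        using scalar(1) zN by (simp add: Nop N'.minus_eq N'.r_neg)
      then have "(\<lambda>i\<in>A. ?q i \<odot>\<^bsub>M\<^esub> y) \<in> W" using Wq lF scalar by simp
      moreover have "?q = (\<lambda>i\<in>A. s \<otimes>\<^bsub>R\<^esub> l z i \<ominus>\<^bsub>R\<^esub> l (s \<odot>\<^bsub>N\<^esub> z) i)"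
        using lF scalar F.smult_closed unfolding F_def
        by (auto simp: M.R.minus_free_mod smult_free_mod intro!: restrict_ext)
      moreover have "h r = (\<lambda>i\<in>A. l z i \<odot>\<^bsub>M\<^esub> (s \<odot>\<^bsub>M\<^esub> y) \<ominus>\<^bsub>M\<^esub> l (s \<odot>\<^bsub>N\<^esub> z) i \<odot>\<^bsub>M\<^esub> y)"
        unfolding scalar(4) using scalar
        by (auto simp: hdiff d hof intro!: restrict_ext)
      ultimately show ?thesis
        using scalar li
        by (simp add: M.minus_eq M.R.minus_eq M.smult_l_distr M.smult_l_minus
            M.smult_assoc1[symmetric] M.R.m_comm cong: restrict_cong)
    qed
  qed
  have hJ: "h r \<in> W" if "r \<in> tensor_rel_group R M N" for r
    using that unfolding tensor_rel_group_def
  proof (induction rule: generate.induct)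
    case one
    then show ?case using W1 h.hom_one by simp
  next
    case (incl r)
    then show ?case by (rule hrel)
  next
    case (inv r)
    have "h (inv\<^bsub>?FG\<^esub> r) = inv\<^bsub>G\<^esub> h r"
      using h.hom_inv subsetD[OF tensor_rels_subset[OF M N] inv] by blast
    then show ?case using Winv hrel[OF inv] by simp
  next
    case (eng a b)
    have "a \<in> carrier ?FG" "b \<in> carrier ?FG"
      using eng(1,2) tensor_rel_group_keys[OF M N, unfolded tensor_rel_group_def] by auto
    then have "h (a \<otimes>\<^bsub>?FG\<^esub> b) = h a \<otimes>\<^bsub>G\<^esub> h b" by (rule h.hom_mult)
    then show ?case using Wmult eng by simp
  qed
  have hC: "h (C S) = (\<lambda>i\<in>A. \<Oplus>\<^bsub>M\<^esub>k\<in>S. l (u k) i \<odot>\<^bsub>M\<^esub> g k)" if "S \<subseteq> A" for S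
    using finite_subset[OF that fin] that
  proof (induction S rule: finite_induct)
    case empty
    then show ?case using h.hom_one by (simp add: C_def G1)
  next
    case (insert k S)
    have "h (C (insert k S)) = h (frag_of (g k, u k) \<otimes>\<^bsub>?FG\<^esub> C S)"
      unfolding C_def using insert.hyps by simp
    also have "\<dots> = h (frag_of (g k, u k)) \<otimes>\<^bsub>G\<^esub> h (C S)"
      by (rule h.hom_mult) (use insert.prems gi uN keysC[of S] in auto)
    also have "\<dots> = (\<lambda>i\<in>A. l (u k) i \<odot>\<^bsub>M\<^esub> g k \<oplus>\<^bsub>M\<^esub> (\<Oplus>\<^bsub>M\<^esub>k\<in>S. l (u k) i \<odot>\<^bsub>M\<^esub> g k))"
      using insert gi uN by (simp add: hof Gm cong: restrict_cong)
    also have "\<dots> = (\<lambda>i\<in>A. \<Oplus>\<^bsub>M\<^esub>k\<in>insert k S. l (u k) i \<odot>\<^bsub>M\<^esub> g k)"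
    proof (rule restrict_ext)
      fix i assume "i \<in> A"
      then have "(\<lambda>k. l (u k) i \<odot>\<^bsub>M\<^esub> g k) \<in> S \<rightarrow> carrier M" "l (u k) i \<odot>\<^bsub>M\<^esub> g k \<in> carrier M"
        using insert.prems gi uN li by auto
      then show "l (u k) i \<odot>\<^bsub>M\<^esub> g k \<oplus>\<^bsub>M\<^esub> (\<Oplus>\<^bsub>M\<^esub>k\<in>S. l (u k) i \<odot>\<^bsub>M\<^esub> g k)
          = (\<Oplus>\<^bsub>M\<^esub>k\<in>insert k S. l (u k) i \<odot>\<^bsub>M\<^esub> g k)"
        using insert.hyps by simp
    qed
    finally show ?case .
  qed
  have "h (C A) \<in> W" by (rule hJ[OF CA])
  then obtain d where d: "d \<in> A \<rightarrow> carrier F" "\<And>i. i \<in> A \<Longrightarrow> h (C A) i = \<mu> (d i)"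
    "\<And>j. j \<in> A \<Longrightarrow> \<phi> (\<lambda>i\<in>A. d i j) = \<zero>\<^bsub>N'\<^esub>"
    unfolding W_def by auto
  define L where "L i = (\<lambda>k\<in>A. l (u k) i)" for i
  have L: "L i \<in> carrier F" if "i \<in> A" for i
    using that li uN by (auto simp: L_def F_def carrier_free_mod)
  have di: "d i \<in> carrier F" if "i \<in> A" for i using d(1) that by auto
  have dL: "\<mu> (d i) = \<mu> (L i)" if "i \<in> A" for i
  proof -
    have "\<mu> (L i) = (\<Oplus>\<^bsub>M\<^esub>k\<in>A. l (u k) i \<odot>\<^bsub>M\<^esub> g k)"
      unfolding \<mu>_def lin_comb_def by (rule M.finsum_cong') (use that li uN gi in \<open>auto simp: L_def\<close>)
    then show ?thesis using d(2)[OF that] hC[of A] that by simp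
  qed
  define c where "c i = unit i \<oplus>\<^bsub>F\<^esub> (d i \<ominus>\<^bsub>F\<^esub> L i)" for i
  have "c \<in> A \<rightarrow> carrier F" using unit di L by (auto simp: c_def)
  moreover have "\<mu> (c i) = g i" if i: "i \<in> A" for i
    using mod_hom_closed[OF \<mu> L[OF i]] gi[OF i]
    by (simp add: c_def mod_hom_add[OF \<mu>] mod_hom_minus[OF \<mu> Fm M] unit di[OF i] L[OF i] dL[OF i]
        \<mu>unit[OF i] M.minus_eq M.r_neg)
  moreover have "\<phi> (\<lambda>i\<in>A. c i j) = \<zero>\<^bsub>N'\<^esub>" if j: "j \<in> A" for j
  proof -
    have luj: "l (u j) \<in> carrier F" using l uN[OF j] by simp
    have "(\<lambda>i\<in>A. c i j) = unit j \<oplus>\<^bsub>F\<^esub> ((\<lambda>i\<in>A. d i j) \<ominus>\<^bsub>F\<^esub> l (u j))"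
      using j di L luj colF[OF d(1) j] unit unfolding F_def
      by (auto simp: c_def F_def M.R.minus_free_mod add_free_mod unit_def unit_fun_def L_def intro!: restrict_ext)
    then have "\<phi> (\<lambda>i\<in>A. c i j) = u j \<oplus>\<^bsub>N'\<^esub> (\<zero>\<^bsub>N'\<^esub> \<ominus>\<^bsub>N'\<^esub> u j)"
      using luj colF[OF d(1) j] unit l(2)[OF uN[OF j]] d(3)[OF j]
      by (simp add: mod_hom_add[OF \<phi>] mod_hom_minus[OF \<phi> Fm N'] \<phi>unit[OF j])
    then show ?thesis using u j by (simp add: N'.minus_eq N'.r_neg Pi_def)
  qed
  ultimately show ?thesis
    unfolding \<mu>_def \<phi>_def F_def by blast
qed

lemma flat_module_equational_criterion:
  assumes flat: "flat_module R M" and fin: "finite A"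
    and g: "g \<in> A \<rightarrow> carrier M" and gen: "lin_comb M A g ` carrier (free_mod R A) = carrier M"
    and x: "x \<in> carrier (free_mod R A)" and x0: "lin_comb M A g x = \<zero>\<^bsub>M\<^esub>"
  shows "\<exists>c\<in>A \<rightarrow> carrier (free_mod R A). (\<forall>i\<in>A. lin_comb M A g (c i) = g i) \<and>
    (\<forall>j\<in>A. (\<Oplus>\<^bsub>R\<^esub>i\<in>A. x i \<otimes>\<^bsub>R\<^esub> c i j) = \<zero>\<^bsub>R\<^esub>)"
proof -
  have M: "module R M" using flat by (simp add: flat_module_def)
  interpret M: module R M by (rule M)
  let ?N = "nat_fun_module R"
  note xi = free_mod_closed[OF x]
  have "{\<lambda>_. \<one>\<^bsub>R\<^esub>} \<in> carrier ?N" by (auto simp: carrier_nat_fun_module)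
  from flat_module_relation[OF flat M.R.module_nat_fun_module fin g gen x x0 this]
  obtain c where c: "c \<in> A \<rightarrow> carrier (free_mod R A)" "\<forall>i\<in>A. lin_comb M A g (c i) = g i"
    and c0: "\<And>j. j \<in> A \<Longrightarrow>
      lin_comb ?N A (\<lambda>i. x i \<odot>\<^bsub>?N\<^esub> {\<lambda>_. \<one>\<^bsub>R\<^esub>}) (\<lambda>i\<in>A. c i j) = \<zero>\<^bsub>?N\<^esub>"
    by blast
  have "(\<Oplus>\<^bsub>R\<^esub>i\<in>A. x i \<otimes>\<^bsub>R\<^esub> c i j) = \<zero>\<^bsub>R\<^esub>" if j: "j \<in> A" for j
  proof -
    have cij: "c i j \<in> carrier R" if "i \<in> A" for i
      using c(1) that j free_mod_closed[of "c i" R A j] by auto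
    have "{\<lambda>_. \<Oplus>\<^bsub>R\<^esub>i\<in>A. (\<lambda>i\<in>A. c i j) i \<otimes>\<^bsub>R\<^esub> (x i \<otimes>\<^bsub>R\<^esub> \<one>\<^bsub>R\<^esub>)} = \<zero>\<^bsub>?N\<^esub>"
      using c0[OF j] cij xi M.R.lin_comb_nat_fun_module[OF fin, of "\<lambda>i. x i \<otimes>\<^bsub>R\<^esub> \<one>\<^bsub>R\<^esub>" "\<lambda>i\<in>A. c i j"]
      by (simp add: smult_nat_fun_module)
    then have "(\<Oplus>\<^bsub>R\<^esub>i\<in>A. (\<lambda>i\<in>A. c i j) i \<otimes>\<^bsub>R\<^esub> (x i \<otimes>\<^bsub>R\<^esub> \<one>\<^bsub>R\<^esub>)) = \<zero>\<^bsub>R\<^esub>"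
      by (auto simp: zero_nat_fun_module fun_eq_iff)
    moreover have "(\<Oplus>\<^bsub>R\<^esub>i\<in>A. (\<lambda>i\<in>A. c i j) i \<otimes>\<^bsub>R\<^esub> (x i \<otimes>\<^bsub>R\<^esub> \<one>\<^bsub>R\<^esub>)) = (\<Oplus>\<^bsub>R\<^esub>i\<in>A. x i \<otimes>\<^bsub>R\<^esub> c i j)"
      by (rule M.R.finsum_cong') (use xi cij in \<open>auto simp: M.R.m_comm\<close>)
    ultimately show ?thesis by simp
  qed
  with c show ?thesis by blast
qed

section \<open>Endomorphisms annihilating the relations\<close>

locale flat_presentation = cring R for R :: "('a, 'r) ring_scheme" (structure) +
  fixes M :: "('a, 'm, 'c) module_scheme" and A :: "'i set" and g :: "'i \<Rightarrow> 'm"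
  assumes flat: "flat_module R M" and fin: "finite A" and g: "g \<in> A \<rightarrow> carrier M"
    and gen: "lin_comb M A g ` carrier (free_mod R A) = carrier M"
begin

abbreviation "F \<equiv> free_mod R A"
abbreviation "\<mu> \<equiv> lin_comb M A g"
abbreviation "unit \<equiv> unit_fun R A"

definition "relations = {x \<in> carrier F. \<mu> x = \<zero>\<^bsub>M\<^esub>}"

definition "lifts = {\<alpha> \<in> mod_hom R F F. \<forall>x\<in>carrier F. \<mu> (\<alpha> x) = \<mu> x}"

sublocale M: module R M
  using flat by (simp add: flat_module_def)

sublocale F: module R F
  by (rule module_free_mod)

lemma mu: "\<mu> \<in> mod_hom R F M"
  by (rule lin_comb_mod_hom[OF M.module_axioms fin g])

lemma mu_unit: "i \<in> A \<Longrightarrow> \<mu> (unit i) = g i"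
  by (rule lin_comb_unit_fun[OF M.module_axioms fin g])

lemmas mu_minus = mod_hom_minus[OF mu F.module_axioms M.module_axioms]
lemmas mu_smult = mod_hom_smult[OF mu]
lemmas mu_closed = mod_hom_closed[OF mu]
lemmas End_minus = mod_hom_minus[OF _ F.module_axioms F.module_axioms]
lemmas End_zero = mod_hom_zero[OF _ F.module_axioms F.module_axioms]

lemma relations_carrier: "x \<in> relations \<Longrightarrow> x \<in> carrier F"
  by (simp add: relations_def)

lemma lifts_End: "\<alpha> \<in> lifts \<Longrightarrow> \<alpha> \<in> mod_hom R F F"
  by (simp add: lifts_def)

lemma lifts_mu: "\<alpha> \<in> lifts \<Longrightarrow> x \<in> carrier F \<Longrightarrow> \<mu> (\<alpha> x) = \<mu> x"
  by (simp add: lifts_def)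

lemma lifts_id: "id \<in> lifts"
  by (simp add: lifts_def mod_hom_id)

lemma lifts_comp: "\<alpha> \<in> lifts \<Longrightarrow> \<beta> \<in> lifts \<Longrightarrow> \<beta> \<circ> \<alpha> \<in> lifts"
  by (auto simp: lifts_def mod_hom_comp mod_hom_closed)

lemma lifts_funpow: "\<alpha> \<in> lifts \<Longrightarrow> \<alpha> ^^ n \<in> lifts"
  by (induction n) (simp_all add: lifts_id lifts_comp)

lemma lifts_relations: "\<alpha> \<in> lifts \<Longrightarrow> x \<in> relations \<Longrightarrow> \<alpha> x \<in> relations"
  by (auto simp: relations_def lifts_def mod_hom_closed)

lemma diff_lift_relations: "\<alpha> \<in> lifts \<Longrightarrow> x \<in> carrier F \<Longrightarrow> x \<ominus>\<^bsub>F\<^esub> \<alpha> x \<in> relations"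
  using mod_hom_closed[OF lifts_End]
  by (simp add: relations_def mu_minus lifts_mu mu_closed M.minus_eq M.r_neg)

lemma End_coord:
  assumes T: "T \<in> mod_hom R F F" and x: "x \<in> carrier F" and j: "j \<in> A"
  shows "T x j = (\<Oplus>i\<in>A. x i \<otimes> T (unit i) j)"
proof -
  have "(\<lambda>i. T (unit i)) \<in> A \<rightarrow> carrier F"
    using mod_hom_closed[OF T unit_fun_closed] by blast
  from lin_comb_free_mod[OF fin this x j] mod_hom_free_mod_eq[OF T F.module_axioms fin x]
  show ?thesis by simp
qed

lemma ex_lift_annihilating:
  assumes x: "x \<in> relations"
  shows "\<exists>\<alpha>\<in>lifts. \<alpha> x = \<zero>\<^bsub>F\<^esub>"
proof -
  have "\<mu> x = \<zero>\<^bsub>M\<^esub>" using x by (simp add: relations_def)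
  from flat_module_equational_criterion[OF flat fin g gen relations_carrier[OF x] this]
  obtain c where c: "c \<in> A \<rightarrow> carrier F" "\<forall>i\<in>A. \<mu> (c i) = g i"
    and c0: "\<forall>j\<in>A. (\<Oplus>i\<in>A. x i \<otimes> c i j) = \<zero>"
    by (elim bexE conjE)
  let ?\<alpha> = "lin_comb F A c"
  have \<alpha>: "?\<alpha> \<in> mod_hom R F F" by (rule lin_comb_mod_hom[OF F.module_axioms fin c(1)])
  have "\<mu> (?\<alpha> y) = \<mu> y" if y: "y \<in> carrier F" for y
  proof -
    have "\<mu> (?\<alpha> y) = lin_comb M A (\<mu> \<circ> c) y"
      by (rule mod_hom_lin_comb[OF mu F.module_axioms M.module_axioms fin c(1) y])
    also have "\<dots> = \<mu> y"
      unfolding lin_comb_def[of M A "\<mu> \<circ> c"] lin_comb_def[of M A g y]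
      by (rule M.finsum_cong') (use c(2) g free_mod_closed[OF y] in auto)
    finally show ?thesis .
  qed
  moreover have "?\<alpha> x = \<zero>\<^bsub>F\<^esub>"
  proof (rule free_mod_eqI)
    show "?\<alpha> x \<in> carrier F" by (rule mod_hom_closed[OF \<alpha> relations_carrier[OF x]])
    fix j assume "j \<in> A"
    then show "?\<alpha> x j = \<zero>\<^bsub>F\<^esub> j"
      using lin_comb_free_mod[OF fin c(1) relations_carrier[OF x]] c0 by (simp add: zero_free_mod)
  qed simp
  ultimately show ?thesis using \<alpha> unfolding lifts_def by blast
qed

lemma ex_lift_annihilating_finite:
  assumes "finite B" "B \<subseteq> relations"
  shows "\<exists>\<alpha>\<in>lifts. \<forall>b\<in>B. \<alpha> b = \<zero>\<^bsub>F\<^esub>"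
  using assms
proof (induction B rule: finite_induct)
  case empty
  then show ?case using lifts_id by blast
next
  case (insert b B)
  then obtain \<alpha> where \<alpha>: "\<alpha> \<in> lifts" "\<forall>b\<in>B. \<alpha> b = \<zero>\<^bsub>F\<^esub>" by auto
  obtain \<beta> where \<beta>: "\<beta> \<in> lifts" "\<beta> (\<alpha> b) = \<zero>\<^bsub>F\<^esub>"
    using ex_lift_annihilating lifts_relations[OF \<alpha>(1)] insert.prems by blast
  show ?case
    using lifts_comp[OF \<alpha>(1) \<beta>(1)] \<alpha>(2) \<beta>(2) End_zero[OF lifts_End[OF \<beta>(1)]]
    by (intro bexI[of _ "\<beta> \<circ> \<alpha>"]) auto
qed

text \<open>At a prime \<open>P\<close>, choose a smallest \<open>S \<subseteq> A\<close> generating \<open>M\<close> up to a factor \<open>d \<notin> P\<close>. By minimality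
  relations supported in \<open>S\<close> have coefficients in \<open>P\<close>, so by flatness and elimination they vanish
  locally at \<open>P\<close>. Hence the finitely many relations expressing the \<open>d g\<^sub>i\<close> through \<open>S\<close> generate all
  relations locally at \<open>P\<close>.\<close>

lemma ex_finite_local_relations:
  assumes P: "primeideal P R"
  shows "\<exists>B. finite B \<and> B \<subseteq> relations \<and> (\<forall>\<alpha>\<in>mod_hom R F F. (\<forall>b\<in>B. \<alpha> b = \<zero>\<^bsub>F\<^esub>) \<longrightarrow>
    (\<forall>x\<in>relations. \<exists>s\<in>carrier R - P. s \<odot>\<^bsub>F\<^esub> \<alpha> x = \<zero>\<^bsub>F\<^esub>))"
proof -
  interpret P: primeideal P R by (rule P)
  define supp where "supp S x \<longleftrightarrow> (\<forall>i\<in>A - S. x i = \<zero>)" for S and x :: "'i \<Rightarrow> 'a"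
  define good where "good S \<longleftrightarrow> S \<subseteq> A \<and> (\<exists>d\<in>carrier R - P. \<forall>k\<in>A. \<exists>c\<in>carrier F.
    supp S c \<and> \<mu> c = d \<odot>\<^bsub>M\<^esub> g k)" for S
  have "good A"
    unfolding good_def
  proof (intro conjI bexI[of _ \<one>] ballI)
    fix k assume k: "k \<in> A"
    then have "g k \<in> carrier M" using g by blast
    then show "\<exists>c\<in>carrier F. supp A c \<and> \<mu> c = \<one> \<odot>\<^bsub>M\<^esub> g k"
      by (intro bexI[of _ "unit k"]) (simp_all add: supp_def mu_unit[OF k] unit_fun_closed)
  qed (use P.I_notcarr P.one_imp_carrier in auto)
  then obtain S where S: "good S" and min: "\<And>S'. good S' \<Longrightarrow> card S \<le> card S'"
    using ex_has_least_nat[of good A card] by blast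
  have SA: "S \<subseteq> A" using S by (simp add: good_def)
  have finS: "finite S" by (rule finite_subset[OF SA fin])
  obtain d where d: "d \<in> carrier R" "d \<notin> P"
    and "\<forall>k\<in>A. \<exists>c\<in>carrier F. supp S c \<and> \<mu> c = d \<odot>\<^bsub>M\<^esub> g k"
    using S unfolding good_def by blast
  then obtain c where c: "\<And>k. k \<in> A \<Longrightarrow> c k \<in> carrier F" "\<And>k. k \<in> A \<Longrightarrow> supp S (c k)"
    "\<And>k. k \<in> A \<Longrightarrow> \<mu> (c k) = d \<odot>\<^bsub>M\<^esub> g k"
    by metis
  have coeff: "x j \<in> P" if x: "x \<in> relations" "supp S x" and j: "j \<in> S" for x j
  proof (rule ccontr)
    assume nP: "x j \<notin> P"
    note xF = relations_carrier[OF x(1)]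
    have jA: "j \<in> A" using j SA by blast
    have xj: "x j \<in> carrier R" using free_mod_closed[OF xF jA] .
    have "good (S - {j})"
      unfolding good_def
    proof (intro conjI bexI[of _ "x j \<otimes> d"] ballI)
      fix k assume k: "k \<in> A"
      let ?c = "x j \<odot>\<^bsub>F\<^esub> c k \<ominus>\<^bsub>F\<^esub> c k j \<odot>\<^bsub>F\<^esub> x"
      have cki: "c k i \<in> carrier R" if "i \<in> A" for i using free_mod_closed[OF c(1)[OF k] that] .
      have cF: "?c \<in> carrier F" using xF c(1)[OF k] xj cki[OF jA] by simp
      have "?c i = \<zero>" if i: "i \<in> A - (S - {j})" for i
      proof -
        have "?c i = x j \<otimes> c k i \<ominus> c k j \<otimes> x i"
          using i xF c(1)[OF k] xj cki[OF jA] by (simp add: minus_free_mod_apply smult_free_mod_apply)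
        also have "\<dots> = \<zero>"
        proof (cases "i = j")
          case True
          then show ?thesis using xj cki[OF jA] by (simp add: m_comm minus_eq r_neg)
        next
          case False
          then have "c k i = \<zero>" "x i = \<zero>" using i x(2) c(2)[OF k] unfolding supp_def by auto
          then show ?thesis using xj cki[OF jA] by (simp add: minus_eq)
        qed
        finally show ?thesis .
      qed
      then have "supp (S - {j}) ?c" unfolding supp_def by blast
      moreover have "\<mu> ?c = (x j \<otimes> d) \<odot>\<^bsub>M\<^esub> g k"
        using x xF c(1)[OF k] c(3)[OF k] xj cki[OF jA] d(1) g k
        by (auto simp: mu_minus mu_smult relations_def M.smult_assoc1 M.minus_eq Pi_def)
      ultimately show "\<exists>c\<in>carrier F. supp (S - {j}) c \<and> \<mu> c = (x j \<otimes> d) \<odot>\<^bsub>M\<^esub> g k"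
        using cF by blast
    qed (use SA xj d nP P.I_prime in auto)
    from min[OF this] have "card S \<le> card (S - {j})" .
    then show False using card_Diff1_less[OF finS j] by simp
  qed

  define C where "C = lin_comb F A c"
  have cA: "c \<in> A \<rightarrow> carrier F" using c(1) by blast
  have C: "C \<in> mod_hom R F F" unfolding C_def by (rule lin_comb_mod_hom[OF F.module_axioms fin cA])
  note C_closed = mod_hom_closed[OF C]
  have suppC: "supp S (C x)" if x: "x \<in> carrier F" for x
    unfolding supp_def
  proof
    fix i assume i: "i \<in> A - S"
    have "C x i = (\<Oplus>k\<in>A. x k \<otimes> c k i)"
      unfolding C_def using lin_comb_free_mod[OF fin cA x] i by simp
    also have "\<dots> = (\<Oplus>k\<in>A. \<zero>)"
      by (rule finsum_cong') (use free_mod_closed[OF x] c(2) i in \<open>auto simp: supp_def\<close>)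
    finally show "C x i = \<zero>" by simp
  qed
  have muC: "\<mu> (C x) = d \<odot>\<^bsub>M\<^esub> \<mu> x" if x: "x \<in> carrier F" for x
  proof -
    have "\<mu> (C x) = lin_comb M A (\<mu> \<circ> c) x"
      unfolding C_def by (rule mod_hom_lin_comb[OF mu F.module_axioms M.module_axioms fin cA x])
    also have "\<dots> = lin_comb M A ((\<lambda>y. d \<odot>\<^bsub>M\<^esub> id y) \<circ> g) x"
      unfolding lin_comb_def
      by (rule M.finsum_cong') (use c(3) g d(1) free_mod_closed[OF x] in \<open>auto simp: lin_comb_def\<close>)
    also have "\<dots> = d \<odot>\<^bsub>M\<^esub> id (\<mu> x)"
      by (rule mod_hom_lin_comb[symmetric, OF mod_hom_smult_map[OF mod_hom_id] M.module_axioms M.module_axioms fin g x])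
        (use d(1) M.module_axioms in auto)
    finally show ?thesis by simp
  qed

  have vanish: "\<exists>s\<in>carrier R - P. s \<odot>\<^bsub>F\<^esub> x = \<zero>\<^bsub>F\<^esub>" if x: "x \<in> relations" "supp S x" for x
  proof -
    note xF = relations_carrier[OF x(1)]
    note xi = free_mod_closed[OF xF]
    obtain \<alpha> where \<alpha>: "\<alpha> \<in> lifts" "\<alpha> x = \<zero>\<^bsub>F\<^esub>" using ex_lift_annihilating[OF x(1)] by blast
    note \<alpha>_closed = mod_hom_closed[OF lifts_End[OF \<alpha>(1)]]
    define b where "b i j = C (\<alpha> (unit i)) j" for i j
    have bc: "b i j \<in> carrier R" if "j \<in> A" for i j
      unfolding b_def by (rule free_mod_closed[OF _ that]) (simp add: C_closed \<alpha>_closed unit_fun_closed)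
    have diff: "d \<otimes> unit i j \<ominus> b i j \<in> P" if i: "i \<in> S" and j: "j \<in> S" for i j
    proof -
      let ?v = "d \<odot>\<^bsub>F\<^esub> unit i \<ominus>\<^bsub>F\<^esub> C (\<alpha> (unit i))"
      have cl: "unit i \<in> carrier F" "\<alpha> (unit i) \<in> carrier F" "C (\<alpha> (unit i)) \<in> carrier F"
        by (simp_all add: C_closed \<alpha>_closed unit_fun_closed)
      have v: "?v k = d \<otimes> unit i k \<ominus> C (\<alpha> (unit i)) k" if "k \<in> A" for k
        using cl d(1) that by (simp add: minus_free_mod_apply smult_free_mod_apply)
      have "\<mu> ?v = d \<odot>\<^bsub>M\<^esub> \<mu> (unit i) \<ominus>\<^bsub>M\<^esub> d \<odot>\<^bsub>M\<^esub> \<mu> (unit i)"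
        using cl d(1) by (simp add: mu_minus mu_smult muC lifts_mu[OF \<alpha>(1)])
      then have "?v \<in> relations"
        using cl d(1) by (simp add: relations_def M.minus_eq M.r_neg mu_closed)
      moreover have "supp S ?v"
        unfolding supp_def
      proof
        fix k assume k: "k \<in> A - S"
        then have "C (\<alpha> (unit i)) k = \<zero>" using suppC[OF cl(2)] unfolding supp_def by blast
        moreover have "unit i k = \<zero>" using k i by (auto simp: unit_fun_def)
        ultimately show "?v k = \<zero>" using v k d(1) by (simp add: minus_eq)
      qed
      ultimately show ?thesis using coeff j v SA unfolding b_def by (metis subsetD)
    qed
    have "\<exists>s\<in>carrier R - P. \<forall>i\<in>S. s \<otimes> x i = \<zero>"
    proof (rule diagonally_dominant_elimination[OF P finS, where b = b])
      show "x \<in> S \<rightarrow> carrier R" using xi SA by blast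
      show "b i j \<in> carrier R" if "j \<in> S" for i j using bc that SA by blast
    next
      fix i assume i: "i \<in> S"
      then have iA: "i \<in> A" using SA by blast
      show "b i i \<notin> P"
      proof
        assume "b i i \<in> P"
        then have "d \<otimes> unit i i \<ominus> b i i \<oplus> b i i \<in> P" using diff[OF i i] by (rule P.a_closed[rotated])
        then show False
          using d bc[OF iA] iA by (simp add: unit_fun_def minus_eq a_assoc l_neg)
      qed
    next
      fix i j assume ij: "i \<in> S" "j \<in> S" "i \<noteq> j"
      then have jA: "j \<in> A" using SA by blast
      have "\<ominus> b i j \<in> P" using diff[OF ij(1,2)] ij jA d(1) bc[OF jA] by (simp add: unit_fun_def minus_eq)
      then have "\<ominus> (\<ominus> b i j) \<in> P" by (rule P.a_inv_closed)
      then show "b i j \<in> P" using bc[OF jA] by simp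
    next
      fix j assume j: "j \<in> S"
      then have jA: "j \<in> A" using SA by blast
      have "(\<Oplus>i\<in>S. x i \<otimes> b i j) = (\<Oplus>i\<in>A. x i \<otimes> b i j)"
        by (rule add.finprod_mono_neutral_cong_left[OF fin SA])
          (use x(2) xi bc[OF jA] SA in \<open>auto simp: supp_def\<close>)
      also have "\<dots> = (C \<circ> \<alpha>) x j"
        using End_coord[OF mod_hom_comp[OF lifts_End[OF \<alpha>(1)] C] xF jA] by (simp add: b_def)
      also have "\<dots> = \<zero>" using \<alpha>(2) End_zero[OF C] jA by (simp add: zero_free_mod)
      finally show "(\<Oplus>i\<in>S. x i \<otimes> b i j) = \<zero>" .
    qed
    then obtain s where s: "s \<in> carrier R - P" "\<And>i. i \<in> S \<Longrightarrow> s \<otimes> x i = \<zero>" by blast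
    have "s \<odot>\<^bsub>F\<^esub> x = \<zero>\<^bsub>F\<^esub>"
    proof (rule free_mod_eqI)
      fix i assume i: "i \<in> A"
      have "s \<otimes> x i = \<zero>"
        using s x(2) i unfolding supp_def by (cases "i \<in> S") auto
      then show "(s \<odot>\<^bsub>F\<^esub> x) i = \<zero>\<^bsub>F\<^esub> i" using i by (simp add: smult_free_mod zero_free_mod)
    qed (use s xF in auto)
    with s(1) show ?thesis by blast
  qed

  define D where "D x = d \<odot>\<^bsub>F\<^esub> id x \<ominus>\<^bsub>F\<^esub> C x" for x
  have D: "D \<in> mod_hom R F F"
    unfolding D_def by (intro mod_hom_diff mod_hom_smult_map mod_hom_id C F.module_axioms d(1))
  have Drel: "D x \<in> relations" if x: "x \<in> carrier F" for x
    using x d(1) mod_hom_closed[OF D x] C_closed[OF x] mu_closed[OF x]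
    unfolding relations_def by (simp add: D_def mu_minus mu_smult muC M.minus_eq M.r_neg)
  define B where "B = (\<lambda>i. D (unit i)) ` A"
  have Bfin: "finite B" "B \<subseteq> relations" unfolding B_def using fin by (auto intro: Drel[OF unit_fun_closed])
  have Bkill: "\<exists>s\<in>carrier R - P. s \<odot>\<^bsub>F\<^esub> \<alpha> x = \<zero>\<^bsub>F\<^esub>"
    if \<alpha>: "\<alpha> \<in> mod_hom R F F" "\<forall>b\<in>B. \<alpha> b = \<zero>\<^bsub>F\<^esub>" and x: "x \<in> relations" for \<alpha> x
  proof -
    note xF = relations_carrier[OF x]
    note \<alpha>_closed = mod_hom_closed[OF \<alpha>(1)]
    have \<alpha>D: "\<alpha> (D x) = \<zero>\<^bsub>F\<^esub>"
    proof (rule free_mod_eqI)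
      show "\<alpha> (D x) \<in> carrier F" by (intro \<alpha>_closed mod_hom_closed[OF D] xF)
      fix j assume j: "j \<in> A"
      have "(\<alpha> \<circ> D) x j = (\<Oplus>i\<in>A. x i \<otimes> (\<alpha> \<circ> D) (unit i) j)"
        by (rule End_coord[OF mod_hom_comp[OF D \<alpha>(1)] xF j])
      also have "\<dots> = (\<Oplus>i\<in>A. \<zero>)"
        by (rule finsum_cong') (use \<alpha>(2) free_mod_closed[OF xF] j in \<open>auto simp: B_def zero_free_mod\<close>)
      finally show "\<alpha> (D x) j = \<zero>\<^bsub>F\<^esub> j" using j by (simp add: zero_free_mod)
    qed simp
    have "\<mu> (C x) = \<zero>\<^bsub>M\<^esub>" using muC[OF xF] x d(1) by (simp add: relations_def)
    then have "C x \<in> relations" using C_closed[OF xF] by (simp add: relations_def)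
    from vanish[OF this suppC[OF xF]] obtain s where s: "s \<in> carrier R" "s \<notin> P" "s \<odot>\<^bsub>F\<^esub> C x = \<zero>\<^bsub>F\<^esub>"
      by blast
    have "d \<odot>\<^bsub>F\<^esub> x = D x \<oplus>\<^bsub>F\<^esub> C x"
      using xF d(1) C_closed[OF xF] by (simp add: D_def F.minus_eq F.a_assoc F.l_neg)
    then have "\<alpha> (d \<odot>\<^bsub>F\<^esub> x) = \<alpha> (C x)"
      using mod_hom_add[OF \<alpha>(1) mod_hom_closed[OF D xF] C_closed[OF xF]] \<alpha>D \<alpha>_closed[OF C_closed[OF xF]]
      by simp
    then have "s \<odot>\<^bsub>F\<^esub> (d \<odot>\<^bsub>F\<^esub> \<alpha> x) = \<alpha> (s \<odot>\<^bsub>F\<^esub> C x)"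
      using xF d(1) s(1) C_closed[OF xF] by (simp add: mod_hom_smult[OF \<alpha>(1)])
    then have "(s \<otimes> d) \<odot>\<^bsub>F\<^esub> \<alpha> x = \<zero>\<^bsub>F\<^esub>"
      using xF d(1) s \<alpha>_closed[OF xF] End_zero[OF \<alpha>(1)] by (simp add: F.smult_assoc1)
    moreover have "s \<otimes> d \<in> carrier R - P" using s d P.I_prime by auto
    ultimately show ?thesis by blast
  qed
  show ?thesis
  proof (intro exI[of _ B] conjI ballI impI Bfin)
    fix \<alpha> x assume "\<alpha> \<in> mod_hom R F F" "\<forall>b\<in>B. \<alpha> b = \<zero>\<^bsub>F\<^esub>" "x \<in> relations"
    then show "\<exists>s\<in>carrier R - P. s \<odot>\<^bsub>F\<^esub> \<alpha> x = \<zero>\<^bsub>F\<^esub>" by (rule Bkill)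
  qed
qed

lemma ex_lift_locally_annihilating:
  assumes Q: "finite Q" and prime: "\<And>P. P \<in> Q \<Longrightarrow> primeideal P R"
  shows "\<exists>\<alpha>\<in>lifts. \<forall>x\<in>relations. \<forall>P\<in>Q. \<exists>s\<in>carrier R - P. s \<odot>\<^bsub>F\<^esub> \<alpha> x = \<zero>\<^bsub>F\<^esub>"
proof -
  have "\<forall>P\<in>Q. \<exists>B. finite B \<and> B \<subseteq> relations \<and> (\<forall>\<alpha>\<in>mod_hom R F F. (\<forall>b\<in>B. \<alpha> b = \<zero>\<^bsub>F\<^esub>) \<longrightarrow>
      (\<forall>x\<in>relations. \<exists>s\<in>carrier R - P. s \<odot>\<^bsub>F\<^esub> \<alpha> x = \<zero>\<^bsub>F\<^esub>))"
    using ex_finite_local_relations[OF prime] by blast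
  from bchoice[OF this] obtain B where B: "\<forall>P\<in>Q. finite (B P) \<and> B P \<subseteq> relations \<and>
      (\<forall>\<alpha>\<in>mod_hom R F F. (\<forall>b\<in>B P. \<alpha> b = \<zero>\<^bsub>F\<^esub>) \<longrightarrow>
      (\<forall>x\<in>relations. \<exists>s\<in>carrier R - P. s \<odot>\<^bsub>F\<^esub> \<alpha> x = \<zero>\<^bsub>F\<^esub>))" ..
  have "finite (\<Union>P\<in>Q. B P)" using Q B by simp
  moreover have "(\<Union>P\<in>Q. B P) \<subseteq> relations" using B by auto
  ultimately obtain \<alpha> where \<alpha>: "\<alpha> \<in> lifts" "\<forall>b\<in>(\<Union>P\<in>Q. B P). \<alpha> b = \<zero>\<^bsub>F\<^esub>"
    using ex_lift_annihilating_finite by meson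
  show ?thesis
  proof (intro bexI[OF _ \<alpha>(1)] ballI)
    fix x P assume x: "x \<in> relations" and P: "P \<in> Q"
    have "\<forall>b\<in>B P. \<alpha> b = \<zero>\<^bsub>F\<^esub>" using \<alpha>(2) P by auto
    with bspec[OF B P] lifts_End[OF \<alpha>(1)] x
    show "\<exists>s\<in>carrier R - P. s \<odot>\<^bsub>F\<^esub> \<alpha> x = \<zero>\<^bsub>F\<^esub>" by simp
  qed
qed

lemma ex_lift_annihilating_all_if_finite_maximal:
  assumes "finite {P. maximalideal P R}"
  shows "\<exists>\<alpha>\<in>lifts. \<forall>x\<in>relations. \<alpha> x = \<zero>\<^bsub>F\<^esub>"
proof -
  obtain \<alpha> where \<alpha>: "\<alpha> \<in> lifts" and
    *: "\<forall>x\<in>relations. \<forall>P\<in>{P. maximalideal P R}. \<exists>s\<in>carrier R - P. s \<odot>\<^bsub>F\<^esub> \<alpha> x = \<zero>\<^bsub>F\<^esub>"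
    using ex_lift_locally_annihilating[OF assms] maximalideal_prime by blast
  have "\<alpha> x = \<zero>\<^bsub>F\<^esub>" if x: "x \<in> relations" for x
    by (rule F.zero_if_locally_zero[OF mod_hom_closed[OF lifts_End[OF \<alpha>] relations_carrier[OF x]]])
      (use * x in blast)
  then show ?thesis using \<alpha> by blast
qed

lemma funpow_in_ideal_if_finite_nilpotent_entries:
  assumes \<theta>: "\<theta> \<in> mod_hom R F F" and "finite E" and "E \<subseteq> carrier R"
    and "\<And>a. a \<in> E \<Longrightarrow> \<exists>n::nat. a [^] n = \<zero>" and "ideal I R"
    and "\<And>i j. i \<in> A \<Longrightarrow> j \<in> A \<Longrightarrow> \<theta> (unit i) j \<in> I \<union> E"
  shows "\<exists>N. \<forall>x\<in>carrier F. \<forall>j\<in>A. (\<theta> ^^ N) x j \<in> I"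
  using assms(2-)
proof (induction E arbitrary: I rule: finite_induct)
  case empty
  interpret I: ideal I R by fact
  have "(\<theta> ^^ 1) x j \<in> I" if x: "x \<in> carrier F" and j: "j \<in> A" for x j
    using End_coord[OF \<theta> x j] free_mod_closed[OF x] empty(4) j
    by (simp add: I.finsum_ideal_closed[OF fin] I.I_l_closed)
  then show ?case by blast
next
  case (insert a E)
  interpret I: ideal I R by fact
  have a: "a \<in> carrier R" using insert.prems(1) by simp
  obtain k :: nat where k: "a [^] k = \<zero>" using insert.prems(2) by blast
  define I' where "I' = I <+>\<^bsub>R\<^esub> PIdl a"
  have I'_iff: "z \<in> I' \<longleftrightarrow> (\<exists>u\<in>I. \<exists>r\<in>carrier R. z = u \<oplus> r \<otimes> a)" for z
    by (auto simp: I'_def set_add_def set_mult_def cgenideal_def)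
  have I': "ideal I' R"
    unfolding I'_def by (rule add_ideals[OF I.is_ideal cgenideal_ideal[OF a]])
  have II': "u \<in> I'" if "u \<in> I" for u
    unfolding I'_iff using that a I.Icarr[OF that] by (intro bexI[of _ u] bexI[of _ \<zero>]) auto
  have aI': "a \<in> I'"
    unfolding I'_iff using a by (intro bexI[of _ \<zero>] bexI[of _ \<one>]) auto
  have "\<exists>N. \<forall>x\<in>carrier F. \<forall>j\<in>A. (\<theta> ^^ N) x j \<in> I'"
    by (rule insert.IH) (use insert.prems I' II' aI' in auto)
  then obtain N where N: "\<And>x j. x \<in> carrier F \<Longrightarrow> j \<in> A \<Longrightarrow> (\<theta> ^^ N) x j \<in> I'" by blast
  let ?T = "\<theta> ^^ N"
  have T: "?T \<in> mod_hom R F F" by (rule mod_hom_funpow[OF \<theta>])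
  note T_closed = mod_hom_closed[OF T]
  have TI: "?T x j \<in> I" if x: "x \<in> carrier F" "\<And>i. i \<in> A \<Longrightarrow> x i \<in> I" and j: "j \<in> A" for x j
    using End_coord[OF T x(1) j] x(2) free_mod_closed[OF T_closed[OF unit_fun_closed] j]
    by (simp add: I.finsum_ideal_closed[OF fin] I.I_r_closed)
  have step: "\<exists>U\<in>carrier F. \<exists>V\<in>carrier F. (\<forall>i\<in>A. U i \<in> I) \<and>
    (?T ^^ m) x = U \<oplus>\<^bsub>F\<^esub> a [^] m \<odot>\<^bsub>F\<^esub> V" if x: "x \<in> carrier F" for x m
  proof (induction m)
    case 0
    then show ?case
      using x by (intro bexI[of _ "\<zero>\<^bsub>F\<^esub>"] bexI[of _ x] conjI ballI)
        (simp_all, simp add: zero_free_mod)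
  next
    case (Suc m)
    then obtain U V where UV: "U \<in> carrier F" "V \<in> carrier F" "\<And>i. i \<in> A \<Longrightarrow> U i \<in> I"
      "(?T ^^ m) x = U \<oplus>\<^bsub>F\<^esub> a [^] m \<odot>\<^bsub>F\<^esub> V" by blast
    have "\<forall>i\<in>A. \<exists>u r. u \<in> I \<and> r \<in> carrier R \<and> ?T V i = u \<oplus> r \<otimes> a"
      using N[OF UV(2)] unfolding I'_iff by blast
    then obtain u r where ur: "\<And>i. i \<in> A \<Longrightarrow> u i \<in> I" "\<And>i. i \<in> A \<Longrightarrow> r i \<in> carrier R"
      "\<And>i. i \<in> A \<Longrightarrow> ?T V i = u i \<oplus> r i \<otimes> a" by metis
    have uc: "u i \<in> carrier R" if "i \<in> A" for i using I.Icarr[OF ur(1)[OF that]] .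
    let ?U = "?T U \<oplus>\<^bsub>F\<^esub> a [^] m \<odot>\<^bsub>F\<^esub> (\<lambda>i\<in>A. u i)" and ?V = "\<lambda>i\<in>A. r i"
    have cl: "(\<lambda>i\<in>A. u i) \<in> carrier F" "?V \<in> carrier F" using uc ur(2) by (auto simp: carrier_free_mod)
    have am: "a [^] m \<in> carrier R" using a by simp
    have UF: "?U \<in> carrier F" using cl am T_closed[OF UV(1)] by simp
    have "?U i \<in> I" if i: "i \<in> A" for i
      using i TI[OF UV(1,3)] I.I_l_closed[OF ur(1)[OF i] am]
      by (simp add: add_free_mod smult_free_mod I.a_closed)
    moreover have "(?T ^^ Suc m) x = ?U \<oplus>\<^bsub>F\<^esub> a [^] Suc m \<odot>\<^bsub>F\<^esub> ?V"
    proof (rule free_mod_eqI)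
      have e: "(?T ^^ Suc m) x = ?T U \<oplus>\<^bsub>F\<^esub> a [^] m \<odot>\<^bsub>F\<^esub> ?T V"
        using UV(4) am UV(1,2) by (simp add: mod_hom_add[OF T] mod_hom_smult[OF T])
      show "(?T ^^ Suc m) x \<in> carrier F" unfolding e using T_closed UV(1,2) am by simp
      show "?U \<oplus>\<^bsub>F\<^esub> a [^] Suc m \<odot>\<^bsub>F\<^esub> ?V \<in> carrier F"
        by (rule F.a_closed[OF UF F.smult_closed[OF nat_pow_closed[OF a] cl(2)]])
      fix i assume i: "i \<in> A"
      have c: "?T U i \<in> carrier R" "u i \<in> carrier R" "r i \<in> carrier R"
        using free_mod_closed[OF T_closed[OF UV(1)] i] uc ur(2) i by auto
      then show "(?T ^^ Suc m) x i = (?U \<oplus>\<^bsub>F\<^esub> a [^] Suc m \<odot>\<^bsub>F\<^esub> ?V) i"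
        unfolding e using i ur(3)[OF i] am a
        by (simp add: add_free_mod smult_free_mod r_distr m_assoc a_assoc m_comm[of a "r i"])
    qed
    ultimately show ?case using UF cl(2) by blast
  qed
  have "(\<theta> ^^ (N * k)) x j \<in> I" if x: "x \<in> carrier F" and j: "j \<in> A" for x j
  proof -
    obtain U V where UV: "U \<in> carrier F" "V \<in> carrier F" "\<And>i. i \<in> A \<Longrightarrow> U i \<in> I"
      "(?T ^^ k) x = U \<oplus>\<^bsub>F\<^esub> a [^] k \<odot>\<^bsub>F\<^esub> V" using step[OF x] by blast
    then have "(?T ^^ k) x = U" by (simp add: k)
    then show ?thesis using UV(3)[OF j] by (simp add: funpow_mult mult.commute)
  qed
  then show ?case by blast
qed

lemma funpow_zero_if_nilpotent_entries:
  assumes \<theta>: "\<theta> \<in> mod_hom R F F"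
    and nil: "\<And>i j. i \<in> A \<Longrightarrow> j \<in> A \<Longrightarrow> \<exists>n::nat. \<theta> (unit i) j [^] n = \<zero>"
  shows "\<exists>N. \<forall>x\<in>carrier F. (\<theta> ^^ N) x = \<zero>\<^bsub>F\<^esub>"
proof -
  let ?E = "(\<lambda>(i, j). \<theta> (unit i) j) ` (A \<times> A)"
  have E: "?E \<subseteq> carrier R"
    using free_mod_closed[OF mod_hom_closed[OF \<theta> unit_fun_closed]] by auto
  have "\<exists>N. \<forall>x\<in>carrier F. \<forall>j\<in>A. (\<theta> ^^ N) x j \<in> {\<zero>}"
  proof (rule funpow_in_ideal_if_finite_nilpotent_entries[OF \<theta> _ E _ zeroideal])
    show "\<theta> (unit i) j \<in> {\<zero>} \<union> ?E" if "i \<in> A" "j \<in> A" for i j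
      using that by (intro UnI2 image_eqI[of _ _ "(i, j)"]) auto
  qed (use fin nil in auto)
  then obtain N where N: "\<forall>x\<in>carrier F. \<forall>j\<in>A. (\<theta> ^^ N) x j \<in> {\<zero>}" ..
  have "(\<theta> ^^ N) x = \<zero>\<^bsub>F\<^esub>" if x: "x \<in> carrier F" for x
    by (rule free_mod_eqI[OF mod_hom_closed[OF mod_hom_funpow[OF \<theta>] x] F.zero_closed])
      (use N x in \<open>auto simp: zero_free_mod\<close>)
  then show ?thesis by blast
qed

text \<open>If \<open>\<beta>\<close> is a lift annihilating a fixed point \<open>y\<close> of \<open>\<alpha>\<close>, then \<open>y\<close> is also a fixed point of
  \<open>\<alpha> (1 - \<beta>)\<close>, whose entries are nilpotent because \<open>1 - \<beta>\<close> takes values in the relations.\<close>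

lemma fixed_relation_zero:
  assumes \<alpha>: "\<alpha> \<in> lifts"
    and nil: "\<And>x j. x \<in> relations \<Longrightarrow> j \<in> A \<Longrightarrow> \<exists>n::nat. \<alpha> x j [^] n = \<zero>"
    and y: "y \<in> relations" "\<alpha> y = y"
  shows "y = \<zero>\<^bsub>F\<^esub>"
proof -
  note yF = relations_carrier[OF y(1)]
  obtain \<beta> where \<beta>: "\<beta> \<in> lifts" "\<beta> y = \<zero>\<^bsub>F\<^esub>" using ex_lift_annihilating[OF y(1)] by blast
  define \<rho> where "\<rho> = \<alpha> \<circ> (\<lambda>v. id v \<ominus>\<^bsub>F\<^esub> \<beta> v)"
  have \<rho>: "\<rho> \<in> mod_hom R F F"
    unfolding \<rho>_def
    by (rule mod_hom_comp[OF mod_hom_diff lifts_End[OF \<alpha>]])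
      (rule mod_hom_id lifts_End[OF \<beta>(1)] F.module_axioms)+
  define T where "T v = id v \<ominus>\<^bsub>F\<^esub> \<rho> v" for v
  have T: "T \<in> mod_hom R F F"
    unfolding T_def by (intro mod_hom_diff mod_hom_id \<rho> F.module_axioms)
  have "\<rho> y = y" using y yF \<beta>(2) by (simp add: \<rho>_def F.minus_zero_right)
  then have Ty: "T y = \<zero>\<^bsub>F\<^esub>" using yF by (simp add: T_def F.minus_eq F.r_neg)
  have \<rho>c: "\<rho> (unit i) j \<in> carrier R" if "j \<in> A" for i j
    by (rule free_mod_closed[OF mod_hom_closed[OF \<rho> unit_fun_closed] that])
  have Tu: "T (unit i) j = unit i j \<ominus> \<rho> (unit i) j" if "j \<in> A" for i j
    unfolding T_def id_apply
    by (rule minus_free_mod_apply[OF unit_fun_closed mod_hom_closed[OF \<rho> unit_fun_closed] that])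
  show ?thesis
  proof (rule F.zero_if_locally_zero[OF yF])
    fix P assume "maximalideal P R"
    then have P: "primeideal P R" by (rule maximalideal_prime)
    interpret P: primeideal P R by (rule P)
    have \<rho>P: "\<rho> (unit i) j \<in> P" if j: "j \<in> A" for i j
      using nil[OF diff_lift_relations[OF \<beta>(1) unit_fun_closed] j] nilpotent_in_prime[OF P \<rho>c[OF j]]
      by (auto simp: \<rho>_def)
    have "\<exists>s\<in>carrier R - P. \<forall>i\<in>A. s \<otimes> y i = \<zero>"
    proof (rule diagonally_dominant_elimination[OF P fin, where b = "\<lambda>i j. T (unit i) j"])
      show "y \<in> A \<rightarrow> carrier R" using free_mod_closed[OF yF] by blast
      show "T (unit i) j \<in> carrier R" if "j \<in> A" for i j
        by (rule free_mod_closed[OF mod_hom_closed[OF T unit_fun_closed] that])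
      show "T (unit i) j \<in> P" if ij: "i \<in> A" "j \<in> A" "i \<noteq> j" for i j
      proof -
        have "unit i j = \<zero>" using ij by (simp add: unit_fun_def)
        then show ?thesis
          using \<rho>P[OF ij(2), of i] \<rho>c[OF ij(2), of i] by (simp add: Tu[OF ij(2)] minus_eq P.a_inv_closed)
      qed
      show "T (unit i) i \<notin> P" if i: "i \<in> A" for i
      proof
        assume "T (unit i) i \<in> P"
        then have "T (unit i) i \<oplus> \<rho> (unit i) i \<in> P" using \<rho>P[OF i] by (rule P.a_closed)
        moreover have "unit i i = \<one>" using i by (simp add: unit_fun_def)
        ultimately have "\<one> \<in> P"
          using \<rho>c[OF i, of i] by (simp add: Tu[OF i] minus_eq a_assoc l_neg)
        then show False using P.I_notcarr P.one_imp_carrier by simp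
      qed
      show "(\<Oplus>i\<in>A. y i \<otimes> T (unit i) j) = \<zero>" if "j \<in> A" for j
        using End_coord[OF T yF that] Ty that by (simp add: zero_free_mod)
    qed
    then obtain s where s: "s \<in> carrier R - P" "\<forall>i\<in>A. s \<otimes> y i = \<zero>" by blast
    have "s \<odot>\<^bsub>F\<^esub> y = \<zero>\<^bsub>F\<^esub>"
      unfolding smult_free_mod zero_free_mod by (rule restrict_ext) (use s(2) in blast)
    then show "\<exists>s\<in>carrier R - P. s \<odot>\<^bsub>F\<^esub> y = \<zero>\<^bsub>F\<^esub>" using s(1) by blast
  qed
qed

lemma ex_lift_annihilating_all_if_finite_minimal:
  assumes "finite {P. minimal_primeideal P R}"
  shows "\<exists>\<alpha>\<in>lifts. \<forall>x\<in>relations. \<alpha> x = \<zero>\<^bsub>F\<^esub>"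
proof -
  let ?Q = "{P. minimal_primeideal P R}"
  have "\<exists>\<alpha>\<in>lifts. \<forall>x\<in>relations. \<forall>P\<in>?Q. \<exists>s\<in>carrier R - P. s \<odot>\<^bsub>F\<^esub> \<alpha> x = \<zero>\<^bsub>F\<^esub>"
    by (rule ex_lift_locally_annihilating[OF assms]) (simp add: minimal_primeideal_def)
  then obtain \<alpha> where \<alpha>: "\<alpha> \<in> lifts"
    and loc: "\<forall>x\<in>relations. \<forall>P\<in>?Q. \<exists>s\<in>carrier R - P. s \<odot>\<^bsub>F\<^esub> \<alpha> x = \<zero>\<^bsub>F\<^esub>" ..
  note \<alpha>E = lifts_End[OF \<alpha>]
  have nil: "\<exists>n::nat. \<alpha> x j [^] n = \<zero>" if x: "x \<in> relations" and j: "j \<in> A" for x j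
  proof (rule nilpotent_if_in_minimal_primes)
    show c: "\<alpha> x j \<in> carrier R"
      by (rule free_mod_closed[OF mod_hom_closed[OF \<alpha>E relations_carrier[OF x]] j])
    fix P assume P: "minimal_primeideal P R"
    then interpret P: primeideal P R by (simp add: minimal_primeideal_def)
    obtain s where s: "s \<in> carrier R" "s \<notin> P" "s \<odot>\<^bsub>F\<^esub> \<alpha> x = \<zero>\<^bsub>F\<^esub>" using loc x P by blast
    have "(s \<odot>\<^bsub>F\<^esub> \<alpha> x) j = \<zero>" using j unfolding s(3) by (simp add: zero_free_mod)
    then have "s \<otimes> \<alpha> x j \<in> P" using j P.zero_closed by (simp add: smult_free_mod_apply)
    then show "\<alpha> x j \<in> P" using P.I_prime[OF s(1) c] s(2) by blast
  qed
  define \<beta> where "\<beta> v = id v \<ominus>\<^bsub>F\<^esub> \<alpha> v" for v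
  have \<beta>: "\<beta> \<in> mod_hom R F F"
    unfolding \<beta>_def by (intro mod_hom_diff mod_hom_id \<alpha>E F.module_axioms)
  have \<beta>rel: "\<beta> v \<in> relations" if "v \<in> carrier F" for v
    using diff_lift_relations[OF \<alpha> that] by (simp add: \<beta>_def)
  have \<theta>: "\<alpha> \<circ> \<beta> \<in> mod_hom R F F" by (rule mod_hom_comp[OF \<beta> \<alpha>E])
  have "\<exists>n::nat. (\<alpha> \<circ> \<beta>) (unit i) j [^] n = \<zero>" if "j \<in> A" for i j
    using nil[OF \<beta>rel[OF unit_fun_closed] that] by simp
  then obtain N where N: "\<And>x. x \<in> carrier F \<Longrightarrow> ((\<alpha> \<circ> \<beta>) ^^ N) x = \<zero>\<^bsub>F\<^esub>"
    using funpow_zero_if_nilpotent_entries[OF \<theta>] by blast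
  have comm: "(\<alpha> ^^ m) (\<beta> x) = \<beta> ((\<alpha> ^^ m) x)" if x: "x \<in> carrier F" for x m
    using End_minus[OF mod_hom_funpow[OF \<alpha>E] x mod_hom_closed[OF \<alpha>E x], of m]
    by (simp add: \<beta>_def funpow_swap1)
  have split: "((\<alpha> \<circ> \<beta>) ^^ m) x = (\<beta> ^^ m) ((\<alpha> ^^ m) x)" if x: "x \<in> carrier F" for x m
    using x
  proof (induction m arbitrary: x)
    case (Suc m)
    have "((\<alpha> \<circ> \<beta>) ^^ Suc m) x = ((\<alpha> \<circ> \<beta>) ^^ m) ((\<alpha> \<circ> \<beta>) x)"
      by (simp only: funpow_Suc_right comp_apply)
    also have "\<dots> = (\<beta> ^^ m) ((\<alpha> ^^ m) ((\<alpha> \<circ> \<beta>) x))"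
      by (rule Suc.IH[OF mod_hom_closed[OF \<theta> Suc.prems]])
    also have "\<dots> = (\<beta> ^^ m) (\<beta> ((\<alpha> ^^ Suc m) x))"
      using comm[OF Suc.prems, of "Suc m"] by (simp only: funpow_Suc_right comp_apply)
    also have "\<dots> = (\<beta> ^^ Suc m) ((\<alpha> ^^ Suc m) x)"
      by (simp only: funpow_Suc_right[of m \<beta>] comp_apply)
    finally show ?case .
  qed simp
  have \<beta>inj: "y = \<zero>\<^bsub>F\<^esub>" if "y \<in> relations" "(\<beta> ^^ m) y = \<zero>\<^bsub>F\<^esub>" for y m
    using that
  proof (induction m arbitrary: y)
    case (Suc m)
    note yF = relations_carrier[OF Suc.prems(1)]
    have "\<beta> y = \<zero>\<^bsub>F\<^esub>"
      by (rule Suc.IH[OF \<beta>rel[OF yF]]) (use Suc.prems(2) in \<open>simp add: funpow_swap1\<close>)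
    then have "\<alpha> y = y"
      using F.eq_if_minus_eq_zero[OF yF mod_hom_closed[OF \<alpha>E yF]] by (simp add: \<beta>_def)
    then show ?case using fixed_relation_zero[OF \<alpha> nil Suc.prems(1)] by blast
  qed simp
  have "(\<alpha> ^^ N) x = \<zero>\<^bsub>F\<^esub>" if x: "x \<in> relations" for x
    using \<beta>inj[OF lifts_relations[OF lifts_funpow[OF \<alpha>] x]] N split relations_carrier[OF x] by metis
  then show ?thesis using lifts_funpow[OF \<alpha>] by blast
qed

lemma projective_if_lift_annihilates_relations:
  assumes \<alpha>: "\<alpha> \<in> lifts" and kill: "\<And>x. x \<in> relations \<Longrightarrow> \<alpha> x = \<zero>\<^bsub>F\<^esub>"
  shows "projective_module TYPE('n) R M"
  unfolding projective_module_def
proof (intro conjI allI impI ballI)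
  show "module R M" by (rule M.module_axioms)
  fix N N' :: "('a, 'n) module" and p f
  assume N: "module R N" and N': "module R N'" and p: "p \<in> mod_hom R N N'" and f: "f \<in> mod_hom R M N'"
    and surj: "p ` carrier N = carrier N'"
  note \<alpha>E = lifts_End[OF \<alpha>]
  have "\<forall>y\<in>carrier M. \<exists>x\<in>carrier F. \<mu> x = y" using gen by (metis imageE)
  then obtain l where l: "\<And>y. y \<in> carrier M \<Longrightarrow> l y \<in> carrier F" "\<And>y. y \<in> carrier M \<Longrightarrow> \<mu> (l y) = y"
    by metis
  have "\<forall>i\<in>A. \<exists>z\<in>carrier N. p z = f (g i)"
  proof
    fix i assume "i \<in> A"
    then have "f (g i) \<in> p ` carrier N" using g mod_hom_closed[OF f] surj by auto
    then show "\<exists>z\<in>carrier N. p z = f (g i)" by auto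
  qed
  then obtain n where n: "\<And>i. i \<in> A \<Longrightarrow> n i \<in> carrier N" "\<And>i. i \<in> A \<Longrightarrow> p (n i) = f (g i)"
    by metis
  have nA: "n \<in> A \<rightarrow> carrier N" using n by blast
  define H where "H = lin_comb N A n \<circ> \<alpha>"
  have H: "H \<in> mod_hom R F N"
    unfolding H_def by (rule mod_hom_comp[OF \<alpha>E lin_comb_mod_hom[OF N fin nA]])
  have Heq: "H x = H y" if xy: "x \<in> carrier F" "y \<in> carrier F" "\<mu> x = \<mu> y" for x y
  proof -
    have "x \<ominus>\<^bsub>F\<^esub> y \<in> relations"
      using xy mu_closed by (simp add: relations_def mu_minus M.minus_eq M.r_neg)
    from kill[OF this] have "\<alpha> x \<ominus>\<^bsub>F\<^esub> \<alpha> y = \<zero>\<^bsub>F\<^esub>" using End_minus[OF \<alpha>E xy(1,2)] by simp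
    then show ?thesis
      using F.eq_if_minus_eq_zero[OF mod_hom_closed[OF \<alpha>E xy(1)] mod_hom_closed[OF \<alpha>E xy(2)]]
      by (simp add: H_def)
  qed
  have pH: "p (H x) = f (\<mu> x)" if x: "x \<in> carrier F" for x
  proof -
    note \<alpha>x = mod_hom_closed[OF \<alpha>E x]
    interpret N': module R N' by (rule N')
    have "p (H x) = lin_comb N' A (p \<circ> n) (\<alpha> x)"
      unfolding H_def comp_apply[of "lin_comb N A n"] by (rule mod_hom_lin_comb[OF p N N' fin nA \<alpha>x])
    also have "\<dots> = lin_comb N' A (f \<circ> g) (\<alpha> x)"
      unfolding lin_comb_def
    proof (rule N'.finsum_cong')
      show "(\<lambda>i. \<alpha> x i \<odot>\<^bsub>N'\<^esub> (f \<circ> g) i) \<in> A \<rightarrow> carrier N'"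
      proof
        fix i assume i: "i \<in> A"
        show "\<alpha> x i \<odot>\<^bsub>N'\<^esub> (f \<circ> g) i \<in> carrier N'"
          using mod_hom_closed[OF f funcset_mem[OF g i]] free_mod_closed[OF \<alpha>x i] by simp
      qed
    qed (use n in auto)
    also have "\<dots> = f (\<mu> (\<alpha> x))"
      by (rule mod_hom_lin_comb[symmetric, OF f M.module_axioms N' fin g \<alpha>x])
    finally show ?thesis using lifts_mu[OF \<alpha> x] by simp
  qed
  show "\<exists>h\<in>mod_hom R M N. \<forall>x\<in>carrier M. p (h x) = f x"
  proof (intro bexI[of _ "H \<circ> l"] ballI)
    fix x assume "x \<in> carrier M"
    then show "p ((H \<circ> l) x) = f x" using pH l by simp
  next
    show "H \<circ> l \<in> mod_hom R M N"
    proof (rule mod_homI)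
      fix x y assume xy: "x \<in> carrier M" "y \<in> carrier M"
      have "H (l (x \<oplus>\<^bsub>M\<^esub> y)) = H (l x \<oplus>\<^bsub>F\<^esub> l y)"
        by (rule Heq) (use xy l in \<open>auto simp: mod_hom_add[OF mu]\<close>)
      then show "(H \<circ> l) (x \<oplus>\<^bsub>M\<^esub> y) = (H \<circ> l) x \<oplus>\<^bsub>N\<^esub> (H \<circ> l) y"
        using xy l by (simp add: mod_hom_add[OF H])
    next
      fix r x assume rx: "r \<in> carrier R" "x \<in> carrier M"
      have "H (l (r \<odot>\<^bsub>M\<^esub> x)) = H (r \<odot>\<^bsub>F\<^esub> l x)"
        by (rule Heq) (use rx l in \<open>auto simp: mu_smult\<close>)
      then show "(H \<circ> l) (r \<odot>\<^bsub>M\<^esub> x) = r \<odot>\<^bsub>N\<^esub> (H \<circ> l) x"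
        using rx l by (simp add: mod_hom_smult[OF H])
    qed (use mod_hom_closed[OF H] l in auto)
  qed
qed

end

lemma fin_gen_module_presentation:
  assumes "fin_gen_module R M"
  obtains A where "finite A" "A \<subseteq> carrier M" "lin_comb M A id ` carrier (free_mod R A) = carrier M"
proof -
  have M: "module R M" using assms by (simp add: fin_gen_module_def)
  interpret M: module R M by (rule M)
  obtain A where A: "finite A" "A \<subseteq> carrier M" "\<And>H. submodule H R M \<Longrightarrow> A \<subseteq> H \<Longrightarrow> H = carrier M"
    using assms unfolding fin_gen_module_def by blast
  have id: "id \<in> A \<rightarrow> carrier M" using A(2) by auto
  have "lin_comb M A id ` carrier (free_mod R A) = carrier M"
  proof (rule A(3))
    show "submodule (lin_comb M A id ` carrier (free_mod R A)) R M"
      by (rule submodule_image_mod_hom[OF lin_comb_mod_hom[OF M A(1) id] M.R.module_free_mod M])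
    show "A \<subseteq> lin_comb M A id ` carrier (free_mod R A)"
    proof
      fix a assume "a \<in> A"
      then have "lin_comb M A id (unit_fun R A a) = a" using lin_comb_unit_fun[OF M A(1) id] by simp
      then show "a \<in> lin_comb M A id ` carrier (free_mod R A)"
        using M.R.unit_fun_closed by (metis imageI)
    qed
  qed
  then show thesis using that A(1,2) by blast
qed

theorem theorem3p9:
  fixes R :: "('a, 'r) ring_scheme"
  assumes "cring R"
    and "finite {P. minimal_primeideal P R} \<or> finite {P. maximalideal P R}"
  shows "S_ring TYPE('m) TYPE('n) R"
  unfolding S_ring_def
proof (intro conjI allI impI)
  show "cring R" by fact
  fix M :: "('a, 'm) module"
  assume fg: "fin_gen_module R M" and flat: "flat_module R M"
  obtain A where A: "finite A" "A \<subseteq> carrier M" "lin_comb M A id ` carrier (free_mod R A) = carrier M"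
    using fin_gen_module_presentation[OF fg] .
  interpret flat_presentation R M A id
    using assms(1) flat A by (intro flat_presentation.intro flat_presentation_axioms.intro) auto
  have "\<exists>\<alpha>\<in>lifts. \<forall>x\<in>relations. \<alpha> x = \<zero>\<^bsub>F\<^esub>"
    using assms(2) ex_lift_annihilating_all_if_finite_minimal
      ex_lift_annihilating_all_if_finite_maximal by blast
  then show "projective_module TYPE('n) R M"
    using projective_if_lift_annihilates_relations by blast
qed

end
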